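(* Let $A \in \mathbb{C}^{N\times n}$ be left-invertible, $x_0 \in \mathbb{C}^n$, $b = Ax_0 \in \mathbb{C}^N$ with $N \ge 2$. Let $E$ be a symmetric set of ordered pairs $(i,j)$, $i \neq j$, $i,j\in\{1,\dots,N\}$, let $D = \{(i,i): 1\le i\le N\}$, and let $B_{ij} = b_i\overline{b_j} + \varepsilon_{ij}$ for $(i,j) \in E \cup D$, where $\varepsilon_{ij} = \overline{\varepsilon_{ji}}$. Let $\sigma \ge 0$, and let $\lambda_2$ be the second smallest eigenvalue of the data-weighted graph Laplacian $L_{|b|}$. Assume $\lambda_2>0$ and $\|\varepsilon\|_1 + \sigma \leq \lambda_2/2$. Let $X \in \mathbb{C}^{n\times n}$ be any Hermitian positive semidefinite matrix with $$\sum_{(i,j)\in E\cup D} |(AXA^* )_{ij} - B_{ij}| \leq \sigma,$$ and let $x = x_1\sqrt{\eta_1}$, where $\eta_1$ is the largest eigenvalue of $X$ and $x_1$ is a corresponding unit-norm eigenvector. Then there exists $\alpha \in [0,2\pi)$ such that $$\frac{\|x - e^{i\alpha}x_0\|}{\|x_0\|} \leq 15\,\kappa(A)^2\,\sqrt{\frac{\|\varepsilon\|_1+\sigma}{\lambda_2}}.$$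
   Context: $\|\cdot\|$ is the Euclidean norm for vectors and the spectral norm for matrices. $\|\varepsilon\|_1 = \sum_{(i,j)\in E\cup D}|\varepsilon_{ij}|$ (sum over ordered pairs). $\kappa(A) = \|A\|\,\|A^+\|$ is the condition number of $A$, with $A^+$ the Moore–Penrose pseudoinverse. "Symmetric" for $E$ means $(i,j)\in E \iff (j,i)\in E$. The data-weighted graph Laplacian $L_{|b|}$ is the real symmetric $N\times N$ matrix with entries $$(L_{|b|})_{ij} = \begin{cases} \sum_{k:(i,k)\in E}|b_k|^2 & \text{if } i=j,\\ -|b_i||b_j| & \text{if } (i,j)\in E,\\ 0 & \text{otherwise.}\end{cases}$$ Its eigenvalues are sorted in increasing order with multiplicity, $\lambda_1\le\lambda_2\le\dots\le\lambda_N$ (and $\lambda_1=0$). *)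

theory Defs
  imports "HOL-Analysis.Analysis" "HOL-Computational_Algebra.Polynomial"
begin

section \<open>Complex matrices\<close>

definition conj_transpose :: "complex ^ 'n ^ 'm \<Rightarrow> complex ^ 'm ^ 'n" where
  "conj_transpose A = (\<chi> i j. cnj (A $ j $ i))"

definition hermitian :: "complex ^ 'n ^ 'n \<Rightarrow> bool" where
  "hermitian A \<longleftrightarrow> conj_transpose A = A"

(* For Hermitian X the quadratic form is real, so taking the real part loses nothing. *)
definition hermitian_psd :: "complex ^ 'n ^ 'n \<Rightarrow> bool" where
  "hermitian_psd X \<longleftrightarrow>
     hermitian X \<and> (\<forall>v. 0 \<le> Re (\<Sum>i\<in>UNIV. cnj (v $ i) * (X *v v) $ i))"

(* The operator norm induced by the Euclidean norm, which is the norm of complex ^ 'n. *)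
definition spectral_norm :: "complex ^ 'n ^ 'm \<Rightarrow> real" where
  "spectral_norm A = onorm (\<lambda>v. A *v v)"

definition is_pseudoinverse :: "complex ^ 'n ^ 'm \<Rightarrow> complex ^ 'm ^ 'n \<Rightarrow> bool" where
  "is_pseudoinverse A P \<longleftrightarrow>
     A ** P ** A = A \<and> P ** A ** P = P \<and> hermitian (A ** P) \<and> hermitian (P ** A)"

definition pseudoinverse :: "complex ^ 'n ^ 'm \<Rightarrow> complex ^ 'm ^ 'n" where
  "pseudoinverse A = (THE P. is_pseudoinverse A P)"

lemma conj_transpose_mult:
  "conj_transpose (A ** B) = conj_transpose B ** conj_transpose A"
  by (simp add: conj_transpose_def matrix_matrix_mult_def vec_eq_iff mult.commute)

lemma is_pseudoinverse_unique:
  assumes P: "is_pseudoinverse A P" and Q: "is_pseudoinverse A Q"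
  shows "P = Q"
proof -
  note p = P[unfolded is_pseudoinverse_def hermitian_def]
  note q = Q[unfolded is_pseudoinverse_def hermitian_def]
  have "(A ** Q) ** (A ** P) = A ** P"
    using q by (simp add: matrix_mul_assoc)
  then have "conj_transpose ((A ** Q) ** (A ** P)) = A ** P"
    using p by simp
  then have AP: "(A ** P) ** (A ** Q) = A ** P"
    unfolding conj_transpose_mult[of "A ** Q" "A ** P"] using p q by simp
  then have AP_AQ: "A ** P = A ** Q"
    using p by (simp add: matrix_mul_assoc)
  have "(P ** A) ** (Q ** A) = P ** A"
    using q by (simp add: matrix_mul_assoc[symmetric])
  then have "conj_transpose ((P ** A) ** (Q ** A)) = P ** A"
    using p by simp
  then have "(Q ** A) ** (P ** A) = P ** A"
    unfolding conj_transpose_mult[of "P ** A" "Q ** A"] using p q by simp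
  then have PA_QA: "P ** A = Q ** A"
    using p by (simp add: matrix_mul_assoc[symmetric])
  have "P = P ** A ** P" using p by simp
  also have "\<dots> = Q ** (A ** P)" by (simp add: PA_QA matrix_mul_assoc)
  also have "\<dots> = Q ** A ** Q" by (simp add: AP_AQ matrix_mul_assoc)
  also have "\<dots> = Q" using q by simp
  finally show ?thesis .
qed

lemma pseudoinverse_eqI: "is_pseudoinverse A P \<Longrightarrow> pseudoinverse A = P"
  unfolding pseudoinverse_def by (blast intro: is_pseudoinverse_unique)

definition condition_number :: "complex ^ 'n ^ 'm \<Rightarrow> real" where
  "condition_number A = spectral_norm A * spectral_norm (pseudoinverse A)"


section \<open>Eigenvalues\<close>

definition is_eigenvector :: "'a::field ^ 'n ^ 'n \<Rightarrow> 'a \<Rightarrow> 'a ^ 'n \<Rightarrow> bool" where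
  "is_eigenvector M \<mu> v \<longleftrightarrow> v \<noteq> 0 \<and> M *v v = \<mu> *s v"

(* Meant for Hermitian matrices, all of whose eigenvalues are real. *)
definition is_largest_eigenvalue :: "complex ^ 'n ^ 'n \<Rightarrow> real \<Rightarrow> bool" where
  "is_largest_eigenvalue X \<eta> \<longleftrightarrow>
     (\<exists>v. is_eigenvector X (of_real \<eta>) v) \<and>
     (\<forall>\<mu>::real. (\<exists>v. is_eigenvector X (of_real \<mu>) v) \<longrightarrow> \<mu> \<le> \<eta>)"

definition charpoly :: "'a::comm_ring_1 ^ 'n ^ 'n \<Rightarrow> 'a poly" where
  "charpoly M = det (mat [:0, 1:] - map_matrix (\<lambda>c. [:c:]) M)"

(* The real eigenvalues in increasing order, repeated according to algebraic multiplicity;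
   for a real symmetric matrix these are all CARD('n) eigenvalues, and the entry at list
   position k is the (k+1)-st smallest. *)
definition sorted_eigenvalues :: "real ^ 'n ^ 'n \<Rightarrow> real list" where
  "sorted_eigenvalues M = sorted_list_of_multiset (proots (charpoly M))"


section \<open>Data-weighted graphs\<close>

definition data_laplacian :: "('N \<times> 'N) set \<Rightarrow> complex ^ 'N \<Rightarrow> real ^ 'N ^ 'N" where
  "data_laplacian E b =
     (\<chi> i j. if i = j then (\<Sum>k | (i, k) \<in> E. (cmod (b $ k))\<^sup>2)
            else if (i, j) \<in> E then - (cmod (b $ i) * cmod (b $ j))
            else 0)"

definition lambda2 :: "('N \<times> 'N) set \<Rightarrow> complex ^ 'N \<Rightarrow> real" where
  "lambda2 E b = sorted_eigenvalues (data_laplacian E b) ! 1"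

definition l1_norm_on :: "('N \<times> 'N) set \<Rightarrow> ('N \<Rightarrow> 'N \<Rightarrow> complex) \<Rightarrow> real" where
  "l1_norm_on S c = (\<Sum>(i, j)\<in>S. cmod (c i j))"

end

theory Submission
  imports Defs
begin

text \<open>The quantity \<lambda>_2 controls how far a vector v is from the line spanned by b: since
removing the phases of the entries of b turns b_i cnj b_j into |b_i| |b_j|, the Laplacian
L_|b| is unitarily equivalent to the Hermitian form
Q(v) = 1/2 \<Sum>(i,j)\<in>E. |v_i b_j - v_j b_i|^2, which vanishes on b and is at least
\<lambda>_2 \<parallel>v\<parallel>^2 on the orthogonal complement of b (lemma
\<open>lambda2_le_complex_quadratic_form\<close>). The form depends on v only through the entries of v v^*
on the edges and the diagonal, that is, through exactly the entries that are measured.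

A positive semidefinite X is a sum of rank-one matrices x_k x_k^*, so A X A^* is the sum of
y_k y_k^* with y_k = A x_k. Put \<delta> = \<parallel>\<epsilon>\<parallel>_1 + \<sigma> and
\<tau> = \<delta> / \<lambda>_2 \<le> 1/2. The measured entries of A X A^* are within \<delta> of those of
b b^* in the entrywise one-norm, and Q vanishes on b; hence
\<Sum>k. Q(y_k) \<le> \<delta> \<parallel>b\<parallel>^2 (\<open>edge_energy_le\<close>). Writing y_k = a_k b + r_k with
r_k orthogonal to b, this gives \<Sum>k. \<parallel>r_k\<parallel>^2 \<le> \<tau> \<parallel>b\<parallel>^2. The diagonal measurements
fix the trace of A X A^* up to \<delta>, and \<lambda>_2 \<le> \<parallel>b\<parallel>^2 turns \<delta> into at most
\<tau> \<parallel>b\<parallel>^2; so \<Sum>k. |a_k|^2 is within 2\<tau> of 1 (\<open>rank_one_projection_bounds\<close>).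

Applying the pseudoinverse A^+, a left inverse of A, yields x_k = a_k x_0 + A^+ r_k.
Expanding X - x_0 x_0^* and using the Cauchy-Schwarz inequality for the mixed terms, its
operator norm is at most \<mu> \<parallel>x_0\<parallel>^2 with \<mu> = 4.6 * \<kappa>(A)^2 * sqrt \<tau>
(\<open>rank_one_perturbation_bound\<close>). The mixed terms are the source of the square root of \<tau>.

Finally, the scaled leading eigenvector of a matrix within \<mu> \<parallel>x_0\<parallel>^2 of x_0 x_0^* is, up to
a phase, within sqrt 10 * \<mu> \<parallel>x_0\<parallel> of x_0 (\<open>top_eigenvector_near_rank_one\<close>), and
4.6 * sqrt 10 < 15.\<close>


section \<open>Minimising a Rayleigh quotient\<close>

text \<open>The sphere of S is compact, so the Rayleigh quotient attains its minimum \<mu> there. At a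
minimiser w the residual r = f w - \<mu> w again lies in S; moving from w in the direction
-r would lower the quotient to first order unless r = 0.

The statement is over a Euclidean space and an invariant subspace so that it serves both for the
real Laplacian on the orthogonal complement of the weights and for a Hermitian matrix, read as a
self-adjoint real-linear map.\<close>

lemma selfadjoint_rayleigh_minimiser:
  fixes f :: "'a::euclidean_space \<Rightarrow> 'a"
  assumes lin: "linear f" and sa: "\<And>v w. v \<bullet> f w = f v \<bullet> w"
    and S: "subspace S" and inv: "\<And>v. v \<in> S \<Longrightarrow> f v \<in> S"
    and w0: "w0 \<in> S" "w0 \<noteq> 0"
  obtains \<mu> w where "w \<in> S" "norm w = 1" "f w = \<mu> *\<^sub>R w"
    "\<And>v. v \<in> S \<Longrightarrow> \<mu> * (v \<bullet> v) \<le> v \<bullet> f v"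
proof -
  let ?K = "sphere 0 1 \<inter> S"
  have "compact ?K"
    using closed_subspace[OF S] by (simp add: compact_Int_closed)
  moreover have "?K \<noteq> {}"
  proof -
    have "w0 /\<^sub>R norm w0 \<in> ?K"
      using w0 S by (auto simp: subspace_scale)
    then show ?thesis by blast
  qed
  moreover have "continuous_on ?K (\<lambda>v. v \<bullet> f v)"
    using lin by (intro continuous_intros linear_continuous_on) (simp add: linear_conv_bounded_linear)
  ultimately obtain w where w: "w \<in> ?K" and min: "\<And>v. v \<in> ?K \<Longrightarrow> w \<bullet> f w \<le> v \<bullet> f v"
    using continuous_attains_inf by metis
  define \<mu> where "\<mu> = w \<bullet> f w"
  have ww: "w \<bullet> w = 1" using w by (simp add: dot_square_norm)
  have bound: "\<mu> * (v \<bullet> v) \<le> v \<bullet> f v" if v: "v \<in> S" for v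
  proof (cases "v = 0")
    case True
    then show ?thesis by simp
  next
    case False
    let ?u = "v /\<^sub>R norm v"
    have "?u \<in> ?K" using v S False by (auto simp: subspace_scale)
    from min[OF this] have "\<mu> \<le> (v \<bullet> f v) / (norm v)\<^sup>2"
      using False by (simp add: \<mu>_def linear_cmul[OF lin] power2_eq_square field_simps)
    then show ?thesis using False by (simp add: dot_square_norm field_simps)
  qed
  define r where "r = f w - \<mu> *\<^sub>R w"
  have rS: "r \<in> S"
    using w S inv by (auto simp: r_def subspace_diff subspace_scale)
  have quad: "0 \<le> 2 * t * (r \<bullet> r) + t\<^sup>2 * (r \<bullet> f r - \<mu> * (r \<bullet> r))" for t
  proof -
    have "w + t *\<^sub>R r \<in> S" using w rS S by (auto simp: subspace_add subspace_scale)
    from bound[OF this]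
    have "\<mu> * ((w + t *\<^sub>R r) \<bullet> (w + t *\<^sub>R r)) \<le> (w + t *\<^sub>R r) \<bullet> f (w + t *\<^sub>R r)" .
    also have "\<dots> = \<mu> + 2 * t * (r \<bullet> f w) + t\<^sup>2 * (r \<bullet> f r)"
      using sa[of w r] by (simp add: linear_add[OF lin] linear_cmul[OF lin] inner_simps \<mu>_def
          power2_eq_square inner_commute algebra_simps)
    also have "\<mu> * ((w + t *\<^sub>R r) \<bullet> (w + t *\<^sub>R r))
        = \<mu> + 2 * t * (\<mu> * (r \<bullet> w)) + t\<^sup>2 * (\<mu> * (r \<bullet> r))"
      using ww by (simp add: inner_simps power2_eq_square inner_commute algebra_simps)
    finally have "0 \<le> 2 * t * (r \<bullet> f w - \<mu> * (r \<bullet> w)) + t\<^sup>2 * (r \<bullet> f r - \<mu> * (r \<bullet> r))"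
      by (simp add: algebra_simps)
    moreover have "r \<bullet> f w - \<mu> * (r \<bullet> w) = r \<bullet> r"
      by (simp add: r_def inner_diff_right)
    ultimately show ?thesis by simp
  qed
  have "r \<bullet> r = 0"
  proof (rule ccontr)
    assume "r \<bullet> r \<noteq> 0"
    then have pos: "r \<bullet> r > 0" by (metis inner_ge_zero less_eq_real_def)
    define G where "G = r \<bullet> f r - \<mu> * (r \<bullet> r)"
    have G: "G \<ge> 0" using bound[OF rS] by (simp add: G_def)
    \<comment> \<open>A small step against the residual; any t in (-2 (r \<bullet> r) / G, 0) would do, and the +1 covers G = 0.\<close>
    define t where "t = - (r \<bullet> r) / (G + 1)"
    have a: "r \<bullet> r = - t * (G + 1)" using G by (simp add: t_def)
    have "0 \<le> 2 * t * (r \<bullet> r) + t\<^sup>2 * G"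
      using quad[of t] unfolding G_def .
    also have "\<dots> = - (t\<^sup>2 * (G + 2))"
      by (subst a) (simp add: power2_eq_square algebra_simps)
    finally have "t\<^sup>2 * (G + 2) \<le> 0" by simp
    moreover have "t \<noteq> 0" using pos a by auto
    ultimately show False using G by (simp add: mult_le_0_iff)
  qed
  then have "f w = \<mu> *\<^sub>R w" by (simp add: r_def)
  with w bound that show thesis by auto
qed


section \<open>Pairs of eigenvectors and the characteristic polynomial\<close>

lemma poly_det:
  fixes P :: "'a::comm_ring_1 poly ^ 'n ^ 'n"
  shows "poly (det P) t = det (map_matrix (\<lambda>p. poly p t) P)"
  unfolding det_def map_matrix_def
  by (simp add: poly_sum poly_prod of_int_poly)

lemma poly_charpoly:
  "poly (charpoly M) t = det (mat t - M)"
  unfolding charpoly_def poly_det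
  by (rule arg_cong[where f = det]) (simp add: vec_eq_iff map_matrix_def mat_def)

text \<open>Extend the two vectors to a basis and enumerate it along the index type so that they land in the
two prescribed rows.\<close>

lemma exists_invertible_with_two_rows:
  fixes u w :: "real ^ 'n"
  assumes ind: "independent {u, w}" and "u \<noteq> w" and "i0 \<noteq> i1"
  obtains Q :: "real ^ 'n ^ 'n" where "det Q \<noteq> 0" "Q $ i0 = u" "Q $ i1 = w"
proof -
  obtain Bs where Bs: "{u, w} \<subseteq> Bs" "independent Bs" "UNIV \<subseteq> span Bs"
    using maximal_independent_subset_extend[OF _ ind, of UNIV] by auto
  have fin: "finite Bs" using Bs(2) by (rule independent_imp_finite)
  have "card Bs = DIM(real ^ 'n)"
    using Bs by (metis basis_card_eq_dim dim_UNIV subset_UNIV)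
  then have "card (Bs - {u, w}) = card (UNIV - {i0, i1})"
    using assms Bs(1) fin by (simp add: card_Diff_subset)
  then obtain h where h: "bij_betw h (UNIV - {i0, i1}) (Bs - {u, w})"
    using finite_same_card_bij[of "UNIV - {i0, i1}" "Bs - {u, w}"] fin by auto
  define Q :: "real ^ 'n ^ 'n" where
    "Q = (\<chi> i. if i = i0 then u else if i = i1 then w else h i)"
  have "v \<in> rows Q" if "v \<in> Bs" for v
  proof (cases "v = u \<or> v = w")
    case True
    then have "v = row i0 Q \<or> v = row i1 Q"
      using \<open>i0 \<noteq> i1\<close> by (auto simp: row_def Q_def)
    then show ?thesis unfolding rows_def by blast
  next
    case False
    then have "v \<in> h ` (UNIV - {i0, i1})"
      using that bij_betw_imp_surj_on[OF h] by simp
    then obtain i where "i \<in> UNIV - {i0, i1}" "v = h i" by (elim imageE)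
    then have "v = row i Q" by (simp add: row_def Q_def)
    then show ?thesis unfolding rows_def by blast
  qed
  then have "span (rows Q) = UNIV"
    using Bs(3) span_mono[of Bs "rows Q"] by blast
  then have "det Q \<noteq> 0"
    using matrix_left_invertible_span_rows[of Q] invertible_left_inverse[of Q] invertible_det_nz[of Q] by simp
  then show thesis using that[of Q] \<open>i0 \<noteq> i1\<close> by (simp add: Q_def)
qed

text \<open>This captures multiplicities, including a double eigenvalue \<alpha> = \<beta>, without a spectral
theorem. Take an invertible constant matrix P having u and w among its rows. By symmetry of
M these rows of P (t I - M) are (t - \<alpha>) u and (t - \<beta>) w, so both factors come out of
the determinant, and det P is a nonzero constant.\<close>

lemma independent_eigenvectors_dvd_charpoly:
  fixes M :: "real ^ 'n ^ 'n"
  assumes sym: "transpose M = M"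
    and u: "M *v u = \<alpha> *s u" and w: "M *v w = \<beta> *s w"
    and ind: "independent {u, w}" and "u \<noteq> w" and i: "(i0::'n) \<noteq> i1"
  shows "[:- \<alpha>, 1:] * [:- \<beta>, 1:] dvd charpoly M"
proof -
  obtain Q :: "real ^ 'n ^ 'n" where Q: "det Q \<noteq> 0" "Q $ i0 = u" "Q $ i1 = w"
    using exists_invertible_with_two_rows[OF ind \<open>u \<noteq> w\<close> i] .
  define P where "P = map_matrix (\<lambda>c. [:c:]) Q"
  define C where "C = mat [:0, 1:] - map_matrix (\<lambda>c. [:c:]) M"
  define c where "c i = (if i = i0 then [:- \<alpha>, 1:] else if i = i1 then [:- \<beta>, 1:] else 1)" for i
  define R where "R i = (if i = i0 \<or> i = i1 then P $ i else (P ** C) $ i)" for i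
  have detP: "det P = [:det Q:]"
  proof -
    have "poly (det P) t = poly [:det Q:] t" for t
    proof -
      have "map_matrix (\<lambda>p. poly p t) P = Q"
        by (simp add: P_def vec_eq_iff map_matrix_def)
      then show ?thesis by (simp add: poly_det)
    qed
    then show ?thesis by (metis poly_eq_poly_eq_iff ext)
  qed
  have row: "(P ** C) $ i = [:- \<gamma>, 1:] *s P $ i" if "M *v (Q $ i) = \<gamma> *s (Q $ i)" for i \<gamma>
  proof -
    have "(P ** C) $ i $ j = ([:- \<gamma>, 1:] *s P $ i) $ j" for j
    proof -
      have "(\<Sum>k\<in>UNIV. Q $ i $ k * M $ k $ j) = (M *v (Q $ i)) $ j"
      proof -
        have "M $ k $ j = M $ j $ k" for k
          using arg_cong[OF sym, of "\<lambda>A. A $ j $ k"] by (simp add: transpose_def)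
        then show ?thesis by (simp add: matrix_vector_mult_def mult.commute)
      qed
      also have "\<dots> = \<gamma> * Q $ i $ j" using that by simp
      finally have *: "(\<Sum>k\<in>UNIV. Q $ i $ k * M $ k $ j) = \<gamma> * Q $ i $ j" .
      have "(P ** C) $ i $ j = (\<Sum>k\<in>UNIV. (if k = j then [:0, Q $ i $ k:] else 0) - [:Q $ i $ k * M $ k $ j:])"
        unfolding matrix_matrix_mult_def P_def C_def map_matrix_def mat_def vec_lambda_beta
        by (intro sum.cong) auto
      also have "\<dots> = [:0, Q $ i $ j:] - [:\<Sum>k\<in>UNIV. Q $ i $ k * M $ k $ j:]"
      proof -
        have "(\<Sum>k\<in>S. [:g k:]) = [:sum g S:]" for S and g :: "'n \<Rightarrow> real"
          by (induction S rule: infinite_finite_induct) auto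
        then show ?thesis by (simp add: sum_subtractf)
      qed
      also have "\<dots> = ([:- \<gamma>, 1:] *s P $ i) $ j"
        by (simp add: * P_def map_matrix_def)
      finally show ?thesis .
    qed
    then show ?thesis by (simp add: vec_eq_iff)
  qed
  have "P ** C = (\<chi> i. c i *s R i)"
    using row[of i0 \<alpha>] row[of i1 \<beta>] u w Q i
    by (subst vec_eq_iff) (auto simp: c_def R_def)
  then have "det P * det C = prod c UNIV * det (\<chi> i. R i)"
    using det_rows_mul[of c R] by (simp only: det_mul[symmetric])
  moreover have "prod c UNIV = [:- \<alpha>, 1:] * [:- \<beta>, 1:]"
  proof -
    have "prod c UNIV = prod c {i0, i1}"
      by (rule prod.mono_neutral_right) (auto simp: c_def)
    then show ?thesis using i by (simp add: c_def)
  qed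
  moreover have "det C = charpoly M" by (simp add: C_def charpoly_def)
  ultimately have "[:det Q:] * charpoly M = [:- \<alpha>, 1:] * [:- \<beta>, 1:] * det (\<chi> i. R i)"
    by (simp only: detP)
  then have "smult (det Q) (charpoly M) = [:- \<alpha>, 1:] * [:- \<beta>, 1:] * det (\<chi> i. R i)"
    by (simp only: mult_pCons_left mult_zero_left pCons_0_0 add_0_right)
  then have "[:- \<alpha>, 1:] * [:- \<beta>, 1:] dvd smult (det Q) (charpoly M)"
    by (rule dvdI)
  then show ?thesis using Q(1) by (simp add: dvd_smult_iff)
qed

lemma second_smallest_le:
  fixes M :: "'a::linorder multiset"
  assumes "{#a, b#} \<subseteq># M" "a \<le> c" "b \<le> c"
  shows "sorted_list_of_multiset M ! 1 \<le> c"
proof (rule ccontr)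
  let ?xs = "sorted_list_of_multiset M"
  assume neg: "\<not> ?xs ! 1 \<le> c"
  have "size {#a, b#} \<le> size M" using assms(1) by (rule size_mset_mono)
  then have "2 \<le> length ?xs"
    by (metis mset_sorted_list_of_multiset size_mset size_add_mset size_empty Suc_1 One_nat_def)
  then obtain x y zs where xs: "?xs = x # y # zs"
    by (metis Suc_le_length_iff numeral_2_eq_2)
  have "sorted ?xs" by simp
  then have "\<forall>z\<in>set zs. y \<le> z" unfolding xs by simp
  moreover have "\<not> y \<le> c" using neg xs by simp
  ultimately have "filter (\<lambda>z. z \<le> c) (y # zs) = []"
    by (auto simp: filter_empty_conv)
  then have "length (filter (\<lambda>z. z \<le> c) ?xs) \<le> 1" unfolding xs by (auto split: if_splits)
  then have "size (filter_mset (\<lambda>z. z \<le> c) M) \<le> 1"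
    by (metis mset_filter mset_sorted_list_of_multiset size_mset)
  moreover have "{#a, b#} \<subseteq># filter_mset (\<lambda>z. z \<le> c) M"
    using multiset_filter_mono[OF assms(1), of "\<lambda>z. z \<le> c"] assms(2,3) by simp
  then have "size {#a, b#} \<le> size (filter_mset (\<lambda>z. z \<le> c) M)" by (rule size_mset_mono)
  ultimately show False by simp
qed

text \<open>Two independent eigenvectors account for two entries of the sorted list of eigenvalues, both at
most \<beta>. The characteristic polynomial has to be nonzero because the multiset of roots of the
zero polynomial is empty.\<close>

lemma second_eigenvalue_le:
  fixes M :: "real ^ 'n ^ 'n"
  assumes sym: "transpose M = M"
    and u: "M *v u = \<alpha> *s u" and w: "M *v w = \<beta> *s w" and "\<alpha> \<le> \<beta>"
    and ind: "independent {u, w}" and "u \<noteq> w" and card: "CARD('n) \<ge> 2"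
    and nz: "charpoly M \<noteq> 0"
  shows "sorted_eigenvalues M ! 1 \<le> \<beta>"
proof -
  obtain i0 i1 :: 'n where "i0 \<noteq> i1"
    using card by (metis UNIV_I card_2_iff' card_le_Suc0_iff_eq finite not_less_eq_eq numeral_2_eq_2)
  then have "[:- \<alpha>, 1:] * [:- \<beta>, 1:] dvd charpoly M"
    using independent_eigenvectors_dvd_charpoly[OF sym u w ind \<open>u \<noteq> w\<close>] by blast
  then obtain q where q: "charpoly M = [:- \<alpha>, 1:] * [:- \<beta>, 1:] * q" by (elim dvdE)
  have "proots (charpoly M) = {#\<alpha>, \<beta>#} + proots q"
  proof -
    have "q \<noteq> 0" using nz q by auto
    have "proots ([:- \<alpha>, 1:] * [:- \<beta>, 1:]) = proots [:- \<alpha>, 1:] + proots [:- \<beta>, 1:]"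
      by (rule proots_mult) auto
    moreover have "proots ([:- \<alpha>, 1:] * [:- \<beta>, 1:] * q) = proots ([:- \<alpha>, 1:] * [:- \<beta>, 1:]) + proots q"
      using \<open>q \<noteq> 0\<close> by (intro proots_mult) auto
    ultimately show ?thesis unfolding q by simp
  qed
  then have "{#\<alpha>, \<beta>#} \<subseteq># proots (charpoly M)" by simp
  then show ?thesis
    unfolding sorted_eigenvalues_def using second_smallest_le \<open>\<alpha> \<le> \<beta>\<close> by blast
qed


section \<open>The spectral gap of the data-weighted Laplacian\<close>

definition weights :: "complex ^ 'N \<Rightarrow> real ^ 'N" where
  "weights b = (\<chi> i. cmod (b $ i))"

lemma weights_nth [simp]: "weights b $ i = cmod (b $ i)"
  by (simp add: weights_def)

lemma norm_weights [simp]: "norm (weights b) = norm b"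
  by (simp add: norm_vec_def)

lemma data_laplacian_mult:
  fixes b :: "complex ^ 'N"
  assumes "irrefl E"
  shows "(data_laplacian E b *v v) $ i
    = (\<Sum>j | (i, j) \<in> E. cmod (b $ j) * (v $ i * cmod (b $ j) - v $ j * cmod (b $ i)))"
proof -
  let ?d = "\<Sum>k | (i, k) \<in> E. (cmod (b $ k))\<^sup>2"
  have ii: "(i, i) \<notin> E" using assms by (simp add: irrefl_def)
  have "(data_laplacian E b *v v) $ i
      = (\<Sum>j\<in>UNIV. (if i = j then ?d * v $ i else 0)
          - (if (i, j) \<in> E then cmod (b $ i) * cmod (b $ j) * v $ j else 0))"
    unfolding matrix_vector_mult_def data_laplacian_def vec_lambda_beta
    by (rule sum.cong) (use ii in auto)
  also have "\<dots> = ?d * v $ i - (\<Sum>j | (i, j) \<in> E. cmod (b $ i) * cmod (b $ j) * v $ j)"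
    by (simp add: sum_subtractf sum.If_cases)
  also have "\<dots> = (\<Sum>j | (i, j) \<in> E. cmod (b $ j) * (v $ i * cmod (b $ j) - v $ j * cmod (b $ i)))"
    by (simp add: sum_distrib_left sum_subtractf power2_eq_square algebra_simps)
  finally show ?thesis .
qed

text \<open>Summing w_i (L v)_i gives one term per ordered edge; averaging it with the term of the reversed
edge, which lies in E by symmetry, completes the product of differences.\<close>

lemma inner_data_laplacian:
  fixes b :: "complex ^ 'N"
  assumes "irrefl E" "sym E"
  shows "w \<bullet> (data_laplacian E b *v v)
    = (\<Sum>(i, j)\<in>E. (w $ i * cmod (b $ j) - w $ j * cmod (b $ i))
                   * (v $ i * cmod (b $ j) - v $ j * cmod (b $ i))) / 2"
proof -
  let ?c = "\<lambda>v i j. v $ i * cmod (b $ j) - v $ j * cmod (b $ i)"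
  let ?g = "\<lambda>i j. w $ i * cmod (b $ j) * ?c v i j"
  have "w \<bullet> (data_laplacian E b *v v) = (\<Sum>i\<in>UNIV. \<Sum>j | (i, j) \<in> E. ?g i j)"
    by (simp add: inner_vec_def data_laplacian_mult[OF \<open>irrefl E\<close>] sum_distrib_left mult.assoc)
  also have "\<dots> = (\<Sum>(i, j)\<in>Sigma UNIV (\<lambda>i. {j. (i, j) \<in> E}). ?g i j)"
    by (rule sum.Sigma) auto
  also have "Sigma UNIV (\<lambda>i. {j. (i, j) \<in> E}) = E" by auto
  finally have 1: "w \<bullet> (data_laplacian E b *v v) = (\<Sum>(i, j)\<in>E. ?g i j)" .
  have "bij_betw prod.swap E E"
    using \<open>sym E\<close> by (force simp: bij_betw_def sym_def)
  from sum.reindex_bij_betw[OF this, of "\<lambda>(i, j). ?g i j"]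
  have 2: "(\<Sum>(i, j)\<in>E. ?g i j) = (\<Sum>(i, j)\<in>E. ?g j i)"
    by (simp add: case_prod_unfold)
  have "2 * (\<Sum>(i, j)\<in>E. ?g i j) = (\<Sum>(i, j)\<in>E. ?g i j + ?g j i)"
    using 2 by (simp add: case_prod_unfold sum.distrib)
  also have "\<dots> = (\<Sum>(i, j)\<in>E. ?c w i j * ?c v i j)"
    by (rule sum.cong) (auto simp: algebra_simps)
  finally show ?thesis using 1 by simp
qed

lemma lagrange_identity:
  fixes v w :: "real ^ 'N"
  shows "(\<Sum>(i, j)\<in>UNIV. (v $ i * w $ j - v $ j * w $ i)\<^sup>2) = 2 * ((v \<bullet> v) * (w \<bullet> w) - (v \<bullet> w)\<^sup>2)"
proof -
  have "(\<Sum>(i, j)\<in>UNIV. (v $ i * w $ j - v $ j * w $ i)\<^sup>2)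
     = (\<Sum>i\<in>UNIV. \<Sum>j\<in>UNIV. (v $ i * v $ i) * (w $ j * w $ j) + (w $ i * w $ i) * (v $ j * v $ j)
          - 2 * ((v $ i * w $ i) * (v $ j * w $ j)))"
    by (simp add: sum.cartesian_product UNIV_Times_UNIV power2_eq_square algebra_simps)
  also have "\<dots> = 2 * ((v \<bullet> v) * (w \<bullet> w) - (v \<bullet> w)\<^sup>2)"
    by (simp add: inner_vec_def sum.distrib sum_subtractf sum_distrib_left[symmetric]
        sum_distrib_right[symmetric] sum_product[symmetric] power2_eq_square)
  finally show ?thesis .
qed

lemma transpose_data_laplacian:
  "sym E \<Longrightarrow> transpose (data_laplacian E b) = data_laplacian E b"
  by (auto simp: vec_eq_iff transpose_def data_laplacian_def sym_def)

lemma data_laplacian_weights: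
  "irrefl E \<Longrightarrow> data_laplacian E b *v weights b = 0"
  by (simp add: vec_eq_iff data_laplacian_mult mult.commute)

text \<open>The Laplacian is positive semidefinite, so -1 is not an eigenvalue and the characteristic
polynomial does not vanish there.\<close>

lemma charpoly_data_laplacian_nonzero:
  fixes b :: "complex ^ 'N"
  assumes "irrefl E" "sym E"
  shows "charpoly (data_laplacian E b) \<noteq> 0"
proof -
  let ?L = "data_laplacian E b"
  have "inj ((*v) (mat (-1) - ?L))"
  proof (rule injI)
    fix v w assume "(mat (-1) - ?L) *v v = (mat (-1) - ?L) *v w"
    then have "(mat (-1) - ?L) *v (v - w) = 0"
      by (simp only: matrix_vector_mult_diff_distrib cancel_comm_monoid_add_class.diff_cancel)
    then have "mat (-1) *v (v - w) - ?L *v (v - w) = 0"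
      by (simp only: matrix_vector_mult_diff_rdistrib)
    moreover have "mat (-1) *v u = - u" for u :: "real ^ 'N"
      by (simp add: vec_eq_iff matrix_vector_mult_def mat_def if_distrib[of "\<lambda>x. x * _"] cong: if_cong)
    ultimately have "?L *v (v - w) = - (v - w)"
      by (simp only: right_minus_eq)
    then have "- ((v - w) \<bullet> (v - w)) = (v - w) \<bullet> (?L *v (v - w))"
      by (simp only: inner_minus_right)
    also have "\<dots> \<ge> 0"
      unfolding inner_data_laplacian[OF assms] by (auto intro!: sum_nonneg)
    finally have "(v - w) \<bullet> (v - w) \<le> 0" by simp
    then show "v = w" by (metis eq_iff_diff_eq_0 inner_gt_zero_iff not_le)
  qed
  then have "det (mat (-1) - ?L) \<noteq> 0"
    using matrix_left_invertible_injective[of "mat (-1) - ?L"] invertible_left_inverse[of "mat (-1) - ?L"]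
      invertible_det_nz[of "mat (-1) - ?L"] by blast
  then have "poly (charpoly ?L) (-1) \<noteq> 0" by (simp add: poly_charpoly)
  then show ?thesis by auto
qed

text \<open>The orthogonal complement of the weights is invariant, and the minimum \<mu> of the Rayleigh
quotient on it is an eigenvalue with an eigenvector orthogonal to the weights. The weights
themselves are an eigenvector for the eigenvalue 0, which is at most \<mu>, so the second smallest eigenvalue is at most \<mu>.\<close>

lemma lambda2_rayleigh:
  fixes b :: "complex ^ 'N"
  assumes E: "irrefl E" "sym E" and card: "CARD('N) \<ge> 2" and "b \<noteq> 0"
    and v: "v \<bullet> weights b = 0"
  shows "lambda2 E b * (v \<bullet> v) \<le> v \<bullet> (data_laplacian E b *v v)"
proof -
  let ?L = "data_laplacian E b" and ?\<beta> = "weights b"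
  let ?S = "{v. ?\<beta> \<bullet> v = 0}"
  have \<beta>0: "?\<beta> \<noteq> 0" using \<open>b \<noteq> 0\<close> norm_weights[of b] by fastforce
  have sa: "v \<bullet> (?L *v w) = (?L *v v) \<bullet> w" for v w
    by (subst (2) inner_commute) (simp add: inner_data_laplacian[OF E] mult.commute)
  have inv: "?L *v v \<in> ?S" for v
    using sa[of ?\<beta> v] by (simp add: data_laplacian_weights[OF E(1)])
  obtain w0 where "w0 \<noteq> 0" "orthogonal ?\<beta> w0"
    using orthogonal_to_vector_exists[of ?\<beta>] card by auto
  then have w0: "w0 \<in> ?S" "w0 \<noteq> 0" by (simp_all add: orthogonal_def)
  obtain \<mu> w where w: "w \<in> ?S" "norm w = 1" "?L *v w = \<mu> *\<^sub>R w"
    and min: "\<And>v. v \<in> ?S \<Longrightarrow> \<mu> * (v \<bullet> v) \<le> v \<bullet> (?L *v v)"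
    using selfadjoint_rayleigh_minimiser[OF matrix_vector_mul_linear sa subspace_hyperplane inv w0]
    by blast
  have "0 \<le> w \<bullet> (?L *v w)"
    unfolding inner_data_laplacian[OF E] by (auto intro!: sum_nonneg)
  then have "0 \<le> \<mu>" using w(2,3) by (simp add: dot_square_norm)
  have ne: "?\<beta> \<noteq> w" using w(1) \<beta>0 by auto
  have "pairwise orthogonal {?\<beta>, w}"
    using w(1) by (auto simp: pairwise_insert orthogonal_def inner_commute)
  moreover have "0 \<notin> {?\<beta>, w}" using \<beta>0 w(2) by auto
  ultimately have ind: "independent {?\<beta>, w}" by (intro pairwise_orthogonal_independent)
  have "lambda2 E b \<le> \<mu>"
    unfolding lambda2_def
    by (rule second_eigenvalue_le[OF transpose_data_laplacian[OF E(2)] _ _ \<open>0 \<le> \<mu>\<close> ind ne card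
          charpoly_data_laplacian_nonzero[OF E]])
      (use w(3) in \<open>simp_all add: data_laplacian_weights[OF E(1)] scalar_mult_eq_scaleR\<close>)
  then have "lambda2 E b * (v \<bullet> v) \<le> \<mu> * (v \<bullet> v)" by (intro mult_right_mono) auto
  also have "\<dots> \<le> v \<bullet> (?L *v v)" using min v by (simp add: inner_commute)
  finally show ?thesis .
qed

text \<open>Enlarging E to all pairs only increases the form, and for all pairs Lagrange's identity evaluates
it to \<parallel>v\<parallel>^2 \<parallel>b\<parallel>^2 on vectors orthogonal to the weights.\<close>

lemma lambda2_le_norm_sq:
  fixes b :: "complex ^ 'N"
  assumes E: "irrefl E" "sym E" and card: "CARD('N) \<ge> 2" and "b \<noteq> 0"
  shows "lambda2 E b \<le> (norm b)\<^sup>2"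
proof -
  let ?\<beta> = "weights b"
  obtain v where v: "v \<noteq> 0" "v \<bullet> ?\<beta> = 0"
    using orthogonal_to_vector_exists[of ?\<beta>] card by (auto simp: orthogonal_def inner_commute)
  have "lambda2 E b * (v \<bullet> v) \<le> v \<bullet> (data_laplacian E b *v v)"
    by (rule lambda2_rayleigh[OF assms v(2)])
  also have "\<dots> = (\<Sum>(i, j)\<in>E. (v $ i * ?\<beta> $ j - v $ j * ?\<beta> $ i)\<^sup>2) / 2"
    by (simp add: inner_data_laplacian[OF E] power2_eq_square)
  also have "\<dots> \<le> (\<Sum>(i, j)\<in>UNIV. (v $ i * ?\<beta> $ j - v $ j * ?\<beta> $ i)\<^sup>2) / 2"
    by (intro divide_right_mono sum_mono2) auto
  also have "\<dots> = (v \<bullet> v) * (norm b)\<^sup>2"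
    unfolding lagrange_identity using v(2) by (simp add: dot_square_norm)
  finally have "lambda2 E b * (v \<bullet> v) \<le> (norm b)\<^sup>2 * (v \<bullet> v)" by (simp add: mult.commute)
  then show ?thesis using v(1) by simp
qed


section \<open>The Hermitian inner product\<close>

text \<open>Conjugate-linear in the first argument. The library inner product on complex vectors is the real
part of this one (lemma \<open>Re_hinner\<close>).\<close>

definition hinner :: "complex ^ 'n \<Rightarrow> complex ^ 'n \<Rightarrow> complex" where
  "hinner u v = (\<Sum>i\<in>UNIV. cnj (u $ i) * v $ i)"

lemma hinner_simps:
  "hinner (u + v) w = hinner u w + hinner v w"
  "hinner w (u + v) = hinner w u + hinner w v"
  "hinner (u - v) w = hinner u w - hinner v w"
  "hinner w (u - v) = hinner w u - hinner w v"
  "hinner (c *s u) w = cnj c * hinner u w"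
  "hinner w (c *s u) = c * hinner w u"
  "hinner 0 w = 0" "hinner w 0 = 0"
  by (simp_all add: hinner_def sum.distrib sum_subtractf sum_distrib_left algebra_simps)

lemma cnj_hinner: "cnj (hinner u v) = hinner v u"
  by (simp add: hinner_def mult.commute)

lemma hinner_self: "hinner v v = of_real ((norm v)\<^sup>2)"
  by (simp add: hinner_def norm_vec_def L2_set_def sum_nonneg complex_norm_square
      mult.commute del: of_real_power)

lemma Re_hinner: "Re (hinner u v) = u \<bullet> v"
  by (simp add: hinner_def inner_vec_def inner_complex_def)

lemma norm_hinner_le: "cmod (hinner u v) \<le> norm u * norm v"
proof -
  have "cmod (hinner u v) \<le> (\<Sum>i\<in>UNIV. \<bar>cmod (u $ i)\<bar> * \<bar>cmod (v $ i)\<bar>)"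
    unfolding hinner_def by (rule order.trans[OF norm_sum]) (simp add: norm_mult)
  also have "\<dots> \<le> norm u * norm v"
    unfolding norm_vec_def by (rule L2_set_mult_ineq)
  finally show ?thesis .
qed

lemma norm_vector_smult: "norm (c *s (v::complex ^ 'n)) = cmod c * norm v"
proof -
  have "complex_of_real ((norm (c *s v))\<^sup>2) = of_real ((cmod c * norm v)\<^sup>2)"
    by (simp add: hinner_self[symmetric] hinner_simps complex_norm_square power_mult_distrib mult.assoc
        del: of_real_power)
  then show ?thesis by (simp del: of_real_power)
qed

lemma norm_diff_smult_sq:
  fixes u v :: "complex ^ 'n"
  shows "(norm (u - c *s v))\<^sup>2 = (norm u)\<^sup>2 + (cmod c)\<^sup>2 * (norm v)\<^sup>2 - 2 * Re (c * hinner u v)"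
proof -
  have "complex_of_real ((norm (u - c *s v))\<^sup>2)
      = hinner u u + (c * cnj c) * hinner v v - (c * hinner u v + cnj (c * hinner u v))"
    by (simp only: hinner_self[symmetric] hinner_simps complex_cnj_mult cnj_hinner) (simp add: algebra_simps)
  also have "\<dots> = of_real ((norm u)\<^sup>2 + (cmod c)\<^sup>2 * (norm v)\<^sup>2 - 2 * Re (c * hinner u v))"
    by (simp only: hinner_self complex_norm_square[symmetric] complex_add_cnj of_real_mult of_real_add of_real_diff)
  finally show ?thesis by (simp only: of_real_eq_iff)
qed

lemma hinner_axis: "hinner (axis k c) v = cnj c * v $ k"
  by (simp add: hinner_def axis_def if_distrib[of cnj] if_distrib[of "\<lambda>x. x * _"] cong: if_cong)


section \<open>The Laplacian as a form on complex vectors\<close>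

text \<open>Removing the phase of b_i from v_i leaves each |v_i b_j - v_j b_i| unchanged and replaces b
by its real weights; the real and imaginary parts of the new vector are then orthogonal to the
weights, and the real estimate applies to each of them.\<close>

lemma lambda2_le_complex_quadratic_form:
  fixes b :: "complex ^ 'N"
  assumes E: "irrefl E" "sym E" and card: "CARD('N) \<ge> 2" and "b \<noteq> 0"
    and v: "hinner b v = 0"
  shows "lambda2 E b * (norm v)\<^sup>2 \<le> (\<Sum>(i, j)\<in>E. (cmod (v $ i * b $ j - v $ j * b $ i))\<^sup>2) / 2"
proof -
  define ph where "ph i = (if b $ i = 0 then 1 else sgn (b $ i))" for i
  have ph1: "cmod (ph i) = 1" for i by (simp add: ph_def norm_sgn)
  have b_ph: "b $ i = ph i * of_real (cmod (b $ i))" for i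
    by (simp add: ph_def sgn_eq)
  define z where "z i = cnj (ph i) * v $ i" for i
  have v_z: "v $ i = ph i * z i" for i
    using ph1[of i] by (simp add: z_def mult.assoc[symmetric] complex_norm_square[symmetric])
  define p q :: "real ^ 'N" where "p = (\<chi> i. Re (z i))" and "q = (\<chi> i. Im (z i))"
  have "hinner b v = (\<Sum>i\<in>UNIV. of_real (cmod (b $ i)) * z i)"
    unfolding hinner_def z_def by (subst b_ph) (simp add: mult_ac)
  then have "hinner b v = Complex (p \<bullet> weights b) (q \<bullet> weights b)"
    by (simp add: complex_eq_iff inner_vec_def p_def q_def mult.commute)
  then have pq: "p \<bullet> weights b = 0" "q \<bullet> weights b = 0"
    using v by (simp_all add: complex_eq_iff)
  have normv: "(norm v)\<^sup>2 = p \<bullet> p + q \<bullet> q"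
  proof -
    have "(norm v)\<^sup>2 = (\<Sum>i\<in>UNIV. (cmod (v $ i))\<^sup>2)"
      by (simp add: norm_vec_def L2_set_def sum_nonneg)
    also have "\<dots> = (\<Sum>i\<in>UNIV. (cmod (z i))\<^sup>2)"
      by (simp add: v_z norm_mult ph1)
    also have "\<dots> = p \<bullet> p + q \<bullet> q"
      by (simp add: inner_vec_def p_def q_def cmod_power2 sum.distrib flip: power2_eq_square)
    finally show ?thesis .
  qed
  have edge: "(cmod (v $ i * b $ j - v $ j * b $ i))\<^sup>2
      = (p $ i * cmod (b $ j) - p $ j * cmod (b $ i))\<^sup>2 + (q $ i * cmod (b $ j) - q $ j * cmod (b $ i))\<^sup>2" for i j
  proof -
    have "v $ i * b $ j - v $ j * b $ i
        = ph i * ph j * (z i * of_real (cmod (b $ j)) - z j * of_real (cmod (b $ i)))"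
      using b_ph[of i] b_ph[of j] v_z[of i] v_z[of j] by (metis (no_types, lifting) mult.assoc mult.commute right_diff_distrib)
    then have "cmod (v $ i * b $ j - v $ j * b $ i)
        = cmod (z i * of_real (cmod (b $ j)) - z j * of_real (cmod (b $ i)))"
      by (simp add: norm_mult ph1)
    then show ?thesis by (simp add: cmod_power2 p_def q_def)
  qed
  have "lambda2 E b * (p \<bullet> p) + lambda2 E b * (q \<bullet> q)
      \<le> p \<bullet> (data_laplacian E b *v p) + q \<bullet> (data_laplacian E b *v q)"
    using lambda2_rayleigh[OF E card \<open>b \<noteq> 0\<close>] pq by (intro add_mono) auto
  also have "\<dots> = (\<Sum>(i, j)\<in>E. (cmod (v $ i * b $ j - v $ j * b $ i))\<^sup>2) / 2"
    unfolding inner_data_laplacian[OF E] edge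
    by (simp add: add_divide_distrib[symmetric] sum.distrib[symmetric] case_prod_unfold power2_eq_square)
  finally show ?thesis by (simp add: normv distrib_left)
qed


section \<open>Positive semidefinite matrices as sums of rank-one matrices\<close>

lemma matrix_mult_axis_nth:
  fixes M :: "complex ^ 'n ^ 'm"
  shows "(M *v axis k c) $ i = M $ i $ k * c"
  by (simp add: matrix_vector_mult_def axis_def if_distrib[of "\<lambda>x. _ * x"] cong: if_cong)

lemma hermitian_nth: "hermitian M \<Longrightarrow> M $ i $ j = cnj (M $ j $ i)"
  unfolding hermitian_def conj_transpose_def by (metis vec_lambda_beta)

lemma hermitian_hinner:
  fixes M :: "complex ^ 'n ^ 'n"
  assumes "hermitian M"
  shows "hinner u (M *v v) = hinner (M *v u) v"
proof -
  have "hinner u (M *v v) = (\<Sum>i\<in>UNIV. \<Sum>j\<in>UNIV. cnj (u $ i) * (M $ i $ j * v $ j))"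
    by (simp add: hinner_def matrix_vector_mult_def sum_distrib_left)
  also have "\<dots> = (\<Sum>j\<in>UNIV. \<Sum>i\<in>UNIV. cnj (u $ i) * (M $ i $ j * v $ j))"
    by (rule sum.swap)
  also have "\<dots> = hinner (M *v u) v"
    by (subst hermitian_nth[OF assms])
      (simp add: hinner_def matrix_vector_mult_def sum_distrib_left sum_distrib_right mult_ac)
  finally show ?thesis .
qed

lemma hermitian_psd_iff:
  "hermitian_psd M \<longleftrightarrow> hermitian M \<and> (\<forall>v. 0 \<le> Re (hinner v (M *v v)))"
  by (simp add: hermitian_psd_def hinner_def)

lemma hermitian_psd_diag:
  fixes M :: "complex ^ 'n ^ 'n"
  assumes "hermitian_psd M"
  shows "M $ k $ k = of_real (Re (M $ k $ k))" "0 \<le> Re (M $ k $ k)"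
proof -
  have "M $ k $ k = cnj (M $ k $ k)"
    using assms hermitian_nth unfolding hermitian_psd_iff by blast
  then show "M $ k $ k = of_real (Re (M $ k $ k))" by (simp add: complex_eq_iff)
  have "hinner (axis k 1) (M *v axis k 1) = M $ k $ k"
    by (simp only: hinner_axis matrix_mult_axis_nth) simp
  then show "0 \<le> Re (M $ k $ k)"
    using assms unfolding hermitian_psd_iff by metis
qed

text \<open>Cauchy-Schwarz for the semidefinite form of M, between v and the k-th unit vector: the form
is nonnegative at v - t z e_k with z = (M v)_k for all real t.\<close>

lemma hermitian_psd_entry_bound:
  fixes M :: "complex ^ 'n ^ 'n"
  assumes M: "hermitian_psd M"
  shows "(cmod ((M *v v) $ k))\<^sup>2 \<le> Re (M $ k $ k) * Re (hinner v (M *v v))"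
proof -
  define z where "z = (M *v v) $ k"
  define m where "m = Re (M $ k $ k)"
  define q where "q = Re (hinner v (M *v v))"
  have h: "hermitian M" and psd: "\<And>v. 0 \<le> Re (hinner v (M *v v))"
    using M by (auto simp: hermitian_psd_iff)
  have m: "0 \<le> m" "M $ k $ k = of_real m"
    using hermitian_psd_diag[OF M, of k] by (simp_all add: m_def)
  have quad: "0 \<le> q - 2 * t * (cmod z)\<^sup>2 + t\<^sup>2 * (cmod z)\<^sup>2 * m" for t
  proof -
    define c where "c = - (of_real t * z)"
    define e where "e = (axis k c :: complex ^ 'n)"
    have ee: "hinner e (M *v e) = of_real (t\<^sup>2 * (cmod z)\<^sup>2 * m)"
    proof -
      have "(M *v e) $ k = M $ k $ k * c"
        by (simp add: e_def matrix_mult_axis_nth)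
      then have "hinner e (M *v e) = cnj c * (of_real m * c)"
        unfolding e_def hinner_axis by (simp add: m)
      also have "\<dots> = of_real (t\<^sup>2 * m) * (z * cnj z)"
        by (simp add: c_def power2_eq_square mult_ac)
      also have "\<dots> = of_real (t\<^sup>2 * m) * of_real ((cmod z)\<^sup>2)"
        by (simp only: complex_norm_square)
      finally show ?thesis by (simp add: mult_ac)
    qed
    have ev: "hinner e (M *v v) = - of_real (t * (cmod z)\<^sup>2)"
    proof -
      have "hinner e (M *v v) = - (of_real t * (z * cnj z))"
        unfolding e_def hinner_axis by (simp add: c_def z_def[symmetric] mult_ac)
      also have "\<dots> = - (of_real t * of_real ((cmod z)\<^sup>2))"
        by (simp only: complex_norm_square)
      finally show ?thesis by simp
    qed
    have ve: "hinner v (M *v e) = - of_real (t * (cmod z)\<^sup>2)"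
      using ev cnj_hinner[of e "M *v v"] hermitian_hinner[OF h, of v e] by simp
    have "0 \<le> Re (hinner (v + e) (M *v (v + e)))" by (rule psd)
    also have "\<dots> = q - 2 * t * (cmod z)\<^sup>2 + t\<^sup>2 * (cmod z)\<^sup>2 * m"
      by (simp add: matrix_vector_right_distrib hinner_simps ee ev ve q_def del: of_real_mult of_real_power)
    finally show ?thesis .
  qed
  have "(cmod z)\<^sup>2 \<le> m * q"
  proof (cases "m = 0")
    case True
    have "(cmod z)\<^sup>2 = 0"
    proof (rule ccontr)
      assume "(cmod z)\<^sup>2 \<noteq> 0"
      \<comment> \<open>For m = 0 the form is affine in t with negative slope, so a large t makes it negative.\<close>
      then show False using quad[of "(q + 1) / (2 * (cmod z)\<^sup>2)"] True by simp
    qed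
    then show ?thesis using True by simp
  next
    case False
    then show ?thesis using quad[of "1 / m"] m(1) by (simp add: field_simps power2_eq_square)
  qed
  then show ?thesis by (simp add: z_def m_def q_def)
qed

lemma hermitian_psd_zero_diag:
  fixes M :: "complex ^ 'n ^ 'n"
  assumes "hermitian_psd M" "Re (M $ k $ k) = 0"
  shows "M $ k $ j = 0"
proof -
  have "(M *v axis j 1) $ k = 0"
    using hermitian_psd_entry_bound[OF assms(1), of "axis j 1" k] assms(2) by simp
  then show ?thesis
    by (simp add: matrix_mult_axis_nth)
qed

text \<open>Cholesky elimination. If the diagonal entry d = M_kk is nonzero, subtracting y y^* with
y = M e_k / sqrt d leaves a Schur complement, which is positive semidefinite by the previous
entry bound and has fewer nonzero diagonal entries. When the diagonal is zero, so is M.\<close>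

lemma hermitian_psd_rank_one_sum:
  fixes M :: "complex ^ 'n ^ 'n"
  assumes "hermitian_psd M"
  shows "\<exists>(m::nat) x. \<forall>i j. M $ i $ j = (\<Sum>k<m. x k $ i * cnj (x k $ j))"
  using assms
proof (induction "card {i. Re (M $ i $ i) \<noteq> 0}" arbitrary: M rule: less_induct)
  case less
  note M = less.prems
  have h: "hermitian M" and psd: "\<And>v. 0 \<le> Re (hinner v (M *v v))"
    using M by (auto simp: hermitian_psd_iff)
  show ?case
  proof (cases "\<exists>k. Re (M $ k $ k) \<noteq> 0")
    case False
    then have "M $ i $ j = 0" for i j
      using hermitian_psd_zero_diag[OF M] by simp
    then show ?thesis by (intro exI[of _ 0]) simp
  next
    case True
    then obtain k where k: "Re (M $ k $ k) \<noteq> 0" by blast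
    define d where "d = Re (M $ k $ k)"
    have d: "d > 0" "M $ k $ k = of_real d"
      using hermitian_psd_diag[OF M, of k] k by (simp_all add: d_def)
    define y where "y = (\<chi> i. M $ i $ k / of_real (sqrt d))"
    define N where "N = (\<chi> i j. M $ i $ j - y $ i * cnj (y $ j))"
    have sqd: "complex_of_real (sqrt d) * of_real (sqrt d) = of_real d"
      using d(1) by (simp flip: of_real_mult)
    have yy: "y $ i * cnj (y $ j) = M $ i $ k * M $ k $ j / of_real d" for i j
      using sqd hermitian_nth[OF h, of k j] by (simp add: y_def)
    have yv: "(cmod (hinner y v))\<^sup>2 = (cmod ((M *v v) $ k))\<^sup>2 / d" for v
    proof -
      have "hinner y v = (M *v v) $ k / of_real (sqrt d)"
        using hermitian_nth[OF h, of k]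
        by (simp add: y_def hinner_def matrix_vector_mult_def sum_divide_distrib)
      then show ?thesis using d(1) by (simp add: norm_divide power_divide)
    qed
    have Nv: "N *v v = M *v v - hinner y v *s y" for v
      by (simp add: N_def vec_eq_iff matrix_vector_mult_def hinner_def 
          sum_subtractf sum_distrib_left algebra_simps)
    have "cnj (M $ j $ i) = M $ i $ j" for i j
      using hermitian_nth[OF h, of i j] by simp
    then have "hermitian N"
      by (simp add: hermitian_def conj_transpose_def vec_eq_iff N_def mult.commute)
    moreover have "0 \<le> Re (hinner v (N *v v))" for v
    proof -
      have "hinner v (N *v v) = hinner v (M *v v) - hinner y v * cnj (hinner y v)"
        by (simp add: Nv hinner_simps cnj_hinner)
      then have "Re (hinner v (N *v v)) = Re (hinner v (M *v v)) - (cmod (hinner y v))\<^sup>2"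
        by (simp flip: complex_norm_square)
      moreover have "(cmod (hinner y v))\<^sup>2 \<le> Re (hinner v (M *v v))"
        using hermitian_psd_entry_bound[OF M, of v k] d by (simp add: yv field_simps)
      ultimately show ?thesis by simp
    qed
    ultimately have N: "hermitian_psd N" by (simp add: hermitian_psd_iff)
    have "{i. Re (N $ i $ i) \<noteq> 0} \<subset> {i. Re (M $ i $ i) \<noteq> 0}"
    proof
      show "{i. Re (N $ i $ i) \<noteq> 0} \<subseteq> {i. Re (M $ i $ i) \<noteq> 0}"
        using hermitian_psd_zero_diag[OF M] by (auto simp: N_def yy)
      have "N $ k $ k = 0" using d by (simp add: N_def yy)
      then show "{i. Re (N $ i $ i) \<noteq> 0} \<noteq> {i. Re (M $ i $ i) \<noteq> 0}" using k by force
    qed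
    then have "card {i. Re (N $ i $ i) \<noteq> 0} < card {i. Re (M $ i $ i) \<noteq> 0}"
      by (intro psubset_card_mono) auto
    from less.hyps[OF this N] obtain m :: nat and x
      where x: "\<And>i j. N $ i $ j = (\<Sum>k<m. x k $ i * cnj (x k $ j))" by blast
    have "M $ i $ j = (\<Sum>k<Suc m. (x(m := y)) k $ i * cnj ((x(m := y)) k $ j))" for i j
      using x[of i j] by (simp add: N_def algebra_simps)
    then show ?thesis by blast
  qed
qed

lemma rank_one_sum_mult:
  fixes X :: "complex ^ 'n ^ 'n" and x :: "nat \<Rightarrow> complex ^ 'n" and m :: nat
  assumes "\<And>i j. X $ i $ j = (\<Sum>k<m. x k $ i * cnj (x k $ j))"
  shows "X *v v = (\<Sum>k<m. hinner (x k) v *s x k)"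
proof -
  have "(X *v v) $ i = (\<Sum>k<m. hinner (x k) v *s x k) $ i" for i
  proof -
    have "(X *v v) $ i = (\<Sum>j\<in>UNIV. \<Sum>k<m. x k $ i * cnj (x k $ j) * v $ j)"
      by (simp add: matrix_vector_mult_def assms sum_distrib_right)
    also have "\<dots> = (\<Sum>k<m. \<Sum>j\<in>UNIV. x k $ i * cnj (x k $ j) * v $ j)" by (rule sum.swap)
    also have "\<dots> = (\<Sum>k<m. hinner (x k) v *s x k) $ i"
      by (simp add: hinner_def sum_distrib_left sum_distrib_right mult_ac)
    finally show ?thesis .
  qed
  then show ?thesis by (simp add: vec_eq_iff)
qed

text \<open>Column j of A X A^* is A (X c), where c is the conjugate of row j of A.\<close>

lemma rank_one_sum_congruence:
  fixes X :: "complex ^ 'n ^ 'n" and x :: "nat \<Rightarrow> complex ^ 'n" and m :: nat and A :: "complex ^ 'n ^ 'N"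
  assumes "\<And>i j. X $ i $ j = (\<Sum>k<m. x k $ i * cnj (x k $ j))"
  shows "(A ** X ** conj_transpose A) $ i $ j = (\<Sum>k<m. (A *v x k) $ i * cnj ((A *v x k) $ j))"
proof -
  define c where "c = (\<chi> q. cnj (A $ j $ q))"
  have "(A ** X ** conj_transpose A) $ i $ j = (A *v (X *v c)) $ i"
    unfolding matrix_vector_mul_assoc
    by (simp add: matrix_vector_mult_def c_def matrix_matrix_mult_def conj_transpose_def)
  also have "A *v (X *v c) = (\<Sum>k<m. hinner (x k) c *s (A *v x k))"
    unfolding rank_one_sum_mult[OF assms] by (simp add: vec.linear_sum vec.sum matrix_vector_mult_scaleR vector_scalar_commute)
  also have "\<dots> $ i = (\<Sum>k<m. (A *v x k) $ i * cnj ((A *v x k) $ j))"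
    by (simp add: hinner_def c_def matrix_vector_mult_def mult_ac)
  finally show ?thesis .
qed


section \<open>Pseudoinverse, spectral norm and largest eigenvalue\<close>

text \<open>For injective A the matrix A^* A is invertible, and (A^* A)^-1 A^* satisfies the Penrose
equations.\<close>

lemma left_inverse_pseudoinverse:
  fixes A :: "complex ^ 'n ^ 'm"
  assumes "\<exists>A' :: complex ^ 'm ^ 'n. A' ** A = mat 1"
  shows "pseudoinverse A ** A = mat 1"
proof -
  let ?H = "conj_transpose A ** A"
  have adj: "hinner v (conj_transpose A *v w) = hinner (A *v v) w" for v w
  proof -
    have "hinner v (conj_transpose A *v w) = (\<Sum>i\<in>UNIV. \<Sum>j\<in>UNIV. cnj (v $ i) * (cnj (A $ j $ i) * w $ j))"
      by (simp add: hinner_def matrix_vector_mult_def sum_distrib_left conj_transpose_def)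
    also have "\<dots> = (\<Sum>j\<in>UNIV. \<Sum>i\<in>UNIV. cnj (v $ i) * (cnj (A $ j $ i) * w $ j))"
      by (rule sum.swap)
    also have "\<dots> = hinner (A *v v) w"
      by (simp add: hinner_def matrix_vector_mult_def sum_distrib_left mult_ac)
    finally show ?thesis .
  qed
  have "inj ((*v) A)" using assms by (simp add: matrix_left_invertible_injective)
  have "inj ((*v) ?H)"
  proof (rule injI)
    fix v w assume "?H *v v = ?H *v w"
    then have "?H *v (v - w) = 0"
      by (simp only: matrix_vector_mult_diff_distrib cancel_comm_monoid_add_class.diff_cancel)
    then have "hinner (A *v (v - w)) (A *v (v - w)) = 0"
      by (simp add: adj[symmetric] matrix_vector_mul_assoc hinner_simps del: matrix_vector_mult_diff_distrib)
    then have "A *v (v - w) = 0" by (simp add: hinner_self)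
    then have "A *v v = A *v w" by (simp add: matrix_vector_mult_diff_distrib)
    then show "v = w" using \<open>inj ((*v) A)\<close> by (simp add: inj_eq)
  qed
  then obtain G where G: "G ** ?H = mat 1"
    using matrix_left_invertible_injective[of ?H] by blast
  then have HG: "?H ** G = mat 1" by (simp add: matrix_left_right_inverse)
  have ct_ct: "conj_transpose (conj_transpose B) = B" for B :: "complex ^ 'a ^ 'b"
    by (simp add: conj_transpose_def vec_eq_iff)
  have ct_1: "conj_transpose (mat 1 :: complex ^ 'n ^ 'n) = mat 1"
    by (simp add: conj_transpose_def vec_eq_iff mat_def)
  have "conj_transpose G = G"
  proof -
    have "conj_transpose G ** ?H = mat 1"
      using arg_cong[OF HG, of conj_transpose] by (simp add: conj_transpose_mult ct_ct ct_1)
    then have "conj_transpose G ** (?H ** G) = G" by (simp add: matrix_mul_assoc)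
    then show ?thesis by (simp add: HG)
  qed
  then have "hermitian (A ** (G ** conj_transpose A))"
    by (simp add: hermitian_def conj_transpose_mult ct_ct matrix_mul_assoc)
  moreover have PA: "G ** conj_transpose A ** A = mat 1"
    using G by (simp add: matrix_mul_assoc)
  ultimately have "is_pseudoinverse A (G ** conj_transpose A)"
    unfolding is_pseudoinverse_def
    by (simp add: hermitian_def ct_1 matrix_mul_assoc[of A _ A, symmetric])
  then have "pseudoinverse A = G ** conj_transpose A" by (rule pseudoinverse_eqI)
  then show ?thesis using G by (simp add: matrix_mul_assoc)
qed

lemma spectral_norm_bound:
  fixes A :: "complex ^ 'n ^ 'm"
  shows "norm (A *v v) \<le> spectral_norm A * norm v" "0 \<le> spectral_norm A"
proof -
  have "linear ((*v) A)"
    by (rule linearI) (simp_all add: matrix_vector_right_distrib,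
        simp add: vec_eq_iff matrix_vector_mult_def scaleR_right.sum)
  then have "bounded_linear ((*v) A)" by (simp add: linear_conv_bounded_linear)
  then show "norm (A *v v) \<le> spectral_norm A * norm v" "0 \<le> spectral_norm A"
    unfolding spectral_norm_def by (auto intro: onorm onorm_pos_le)
qed

text \<open>Apply the minimisation principle to -X: the maximal Rayleigh quotient is itself an eigenvalue.\<close>

lemma largest_eigenvalue_rayleigh:
  fixes X :: "complex ^ 'n ^ 'n"
  assumes h: "hermitian X" and e: "is_largest_eigenvalue X \<eta>"
  shows "Re (hinner v (X *v v)) \<le> \<eta> * (norm v)\<^sup>2"
proof -
  let ?f = "\<lambda>v. - (X *v v)"
  have sc: "X *v (r *\<^sub>R v) = r *\<^sub>R (X *v v)" for r v
    by (simp add: vec_eq_iff matrix_vector_mult_def scaleR_right.sum)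
  have lin: "linear ?f"
    by (rule linearI) (simp_all add: matrix_vector_right_distrib sc)
  have sa: "u \<bullet> ?f w = ?f u \<bullet> w" for u w
    using arg_cong[OF hermitian_hinner[OF h, of u w], of Re] by (simp add: Re_hinner)
  have one: "(axis undefined 1 :: complex ^ 'n) \<in> UNIV" "(axis undefined 1 :: complex ^ 'n) \<noteq> 0"
    by (simp_all add: axis_eq_0_iff)
  obtain \<mu> w where w: "norm w = 1" "?f w = \<mu> *\<^sub>R w"
    and min: "\<And>v. v \<in> UNIV \<Longrightarrow> \<mu> * (v \<bullet> v) \<le> v \<bullet> ?f v"
    using selfadjoint_rayleigh_minimiser[OF lin sa subspace_UNIV UNIV_I one] by blast
  have "X *v w = of_real (- \<mu>) *s w"
  proof -
    have "\<mu> *\<^sub>R w = of_real \<mu> *s w"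
      by (simp add: vec_eq_iff scaleR_conv_of_real[where 'a = complex])
    then have "X *v w = - (of_real \<mu> *s w)" using w(2) by (metis minus_minus)
    then show ?thesis by (simp add: vec_eq_iff)
  qed
  then have "is_eigenvector X (of_real (- \<mu>)) w"
    using w(1) by (auto simp: is_eigenvector_def)
  then have "- \<mu> \<le> \<eta>" using e unfolding is_largest_eigenvalue_def by blast
  have "Re (hinner v (X *v v)) \<le> - \<mu> * (norm v)\<^sup>2"
    using min[of v] by (simp add: Re_hinner dot_square_norm)
  also have "\<dots> \<le> \<eta> * (norm v)\<^sup>2" using \<open>- \<mu> \<le> \<eta>\<close> by (intro mult_right_mono) auto
  finally show ?thesis .
qed


section \<open>Measurements close to those of a rank-one matrix\<close>

text \<open>The left-hand side is linear in Y = \<Sum>k. y_k y_k^* and vanishes for Y = b b^*, so Y may be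
replaced by D = Y - b b^*. Each diagonal entry of D then occurs with total weight at most
\<parallel>b\<parallel>^2, and so does each edge entry.\<close>

lemma edge_energy_le:
  fixes b :: "complex ^ 'N" and y :: "nat \<Rightarrow> complex ^ 'N" and m :: nat
  defines "D \<equiv> \<lambda>i j. (\<Sum>k<m. y k $ i * cnj (y k $ j)) - b $ i * cnj (b $ j)"
  assumes "irrefl E"
  shows "(\<Sum>k<m. \<Sum>(i, j)\<in>E. (cmod (y k $ i * b $ j - y k $ j * b $ i))\<^sup>2) / 2
    \<le> (norm b)\<^sup>2 * l1_norm_on (E \<union> Id) D"
proof -
  let ?\<beta> = "\<lambda>i. cmod (b $ i)"
  let ?Y = "\<lambda>i j. \<Sum>k<m. y k $ i * cnj (y k $ j)"
  have sq: "(cmod (p * b' - q * b''))\<^sup>2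
      = Re (p * cnj p) * (cmod b')\<^sup>2 + Re (q * cnj q) * (cmod b'')\<^sup>2 - 2 * Re (p * cnj q * (b' * cnj b''))"
    for p q b' b'' :: complex
    unfolding cmod_power2 by (simp add: power2_eq_square algebra_simps)
  have "(\<Sum>k<m. \<Sum>(i, j)\<in>E. (cmod (y k $ i * b $ j - y k $ j * b $ i))\<^sup>2)
      = (\<Sum>(i, j)\<in>E. \<Sum>k<m. (cmod (y k $ i * b $ j - y k $ j * b $ i))\<^sup>2)"
    unfolding case_prod_unfold by (rule sum.swap)
  also have "\<dots> = (\<Sum>(i, j)\<in>E. Re (?Y i i) * (?\<beta> j)\<^sup>2 + Re (?Y j j) * (?\<beta> i)\<^sup>2
      - 2 * Re (?Y i j * (b $ j * cnj (b $ i))))"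
    unfolding sq by (simp only: sum.distrib sum_subtractf sum_distrib_left sum_distrib_right Re_sum)
  also have "\<dots> = (\<Sum>(i, j)\<in>E. Re (D i i) * (?\<beta> j)\<^sup>2 + Re (D j j) * (?\<beta> i)\<^sup>2
      - 2 * Re (D i j * (b $ j * cnj (b $ i))))"
  proof (intro sum.cong refl, clarify)
    fix i j
    have Y: "?Y i j = D i j + b $ i * cnj (b $ j)" for i j by (simp add: D_def)
    \<comment> \<open>The energy of b b^* itself vanishes on every edge.\<close>
    have "Re (b $ i * cnj (b $ i)) * (?\<beta> j)\<^sup>2 + Re (b $ j * cnj (b $ j)) * (?\<beta> i)\<^sup>2
        - 2 * Re (b $ i * cnj (b $ j) * (b $ j * cnj (b $ i))) = 0"
      using sq[of "b $ i" "b $ j" "b $ j" "b $ i"] by (simp add: mult.commute)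
    then show "Re (?Y i i) * (?\<beta> j)\<^sup>2 + Re (?Y j j) * (?\<beta> i)\<^sup>2 - 2 * Re (?Y i j * (b $ j * cnj (b $ i)))
        = Re (D i i) * (?\<beta> j)\<^sup>2 + Re (D j j) * (?\<beta> i)\<^sup>2 - 2 * Re (D i j * (b $ j * cnj (b $ i)))"
      unfolding Y by (simp add: algebra_simps)
  qed
  also have "\<dots> \<le> (\<Sum>(i, j)\<in>E. cmod (D i i) * (?\<beta> j)\<^sup>2 + cmod (D j j) * (?\<beta> i)\<^sup>2
      + 2 * (cmod (D i j) * (norm b)\<^sup>2))"
  proof (intro sum_mono, clarify)
    fix i j
    have "- Re (D i j * (b $ j * cnj (b $ i))) \<le> cmod (D i j * (b $ j * cnj (b $ i)))"
      using abs_Re_le_cmod[of "D i j * (b $ j * cnj (b $ i))"] by simp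
    also have "\<dots> = cmod (D i j) * (?\<beta> j * ?\<beta> i)" by (simp add: norm_mult)
    also have "\<dots> \<le> cmod (D i j) * (norm b)\<^sup>2"
      unfolding power2_eq_square
      by (intro mult_left_mono mult_mono Finite_Cartesian_Product.norm_nth_le) auto
    finally have "- Re (D i j * (b $ j * cnj (b $ i))) \<le> cmod (D i j) * (norm b)\<^sup>2" .
    moreover have "Re (D i i) * (?\<beta> j)\<^sup>2 \<le> cmod (D i i) * (?\<beta> j)\<^sup>2"
        "Re (D j j) * (?\<beta> i)\<^sup>2 \<le> cmod (D j j) * (?\<beta> i)\<^sup>2"
      by (intro mult_right_mono complex_Re_le_cmod; simp)+
    ultimately show "Re (D i i) * (?\<beta> j)\<^sup>2 + Re (D j j) * (?\<beta> i)\<^sup>2 - 2 * Re (D i j * (b $ j * cnj (b $ i)))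
        \<le> cmod (D i i) * (?\<beta> j)\<^sup>2 + cmod (D j j) * (?\<beta> i)\<^sup>2 + 2 * (cmod (D i j) * (norm b)\<^sup>2)"
      by linarith
  qed
  also have "\<dots> = (\<Sum>(i, j)\<in>E. cmod (D i i) * (?\<beta> j)\<^sup>2) + (\<Sum>(i, j)\<in>E. cmod (D j j) * (?\<beta> i)\<^sup>2)
      + 2 * (norm b)\<^sup>2 * (\<Sum>(i, j)\<in>E. cmod (D i j))"
    unfolding case_prod_unfold by (simp only: sum.distrib sum_distrib_left mult_ac)
  also have "(\<Sum>(i, j)\<in>E. cmod (D i i) * (?\<beta> j)\<^sup>2) \<le> (\<Sum>(i, j)\<in>UNIV. cmod (D i i) * (?\<beta> j)\<^sup>2)"
    by (intro sum_mono2) auto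
  also have "\<dots> = (\<Sum>i\<in>UNIV. cmod (D i i)) * (norm b)\<^sup>2"
    by (simp add: sum_product sum.cartesian_product norm_vec_def L2_set_def sum_nonneg flip: UNIV_Times_UNIV)
  also have "(\<Sum>(i, j)\<in>E. cmod (D j j) * (?\<beta> i)\<^sup>2) \<le> (\<Sum>(i, j)\<in>UNIV. cmod (D j j) * (?\<beta> i)\<^sup>2)"
    by (intro sum_mono2) auto
  also have "\<dots> = (\<Sum>(i, j)\<in>UNIV. cmod (D i i) * (?\<beta> j)\<^sup>2)"
    by (rule sum.reindex_bij_witness[of _ prod.swap prod.swap]) auto
  also have "\<dots> = (\<Sum>i\<in>UNIV. cmod (D i i)) * (norm b)\<^sup>2"
    by (simp add: sum_product sum.cartesian_product norm_vec_def L2_set_def sum_nonneg flip: UNIV_Times_UNIV)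
  finally have *: "(\<Sum>k<m. \<Sum>(i, j)\<in>E. (cmod (y k $ i * b $ j - y k $ j * b $ i))\<^sup>2)
      \<le> 2 * ((norm b)\<^sup>2 * ((\<Sum>i\<in>UNIV. cmod (D i i)) + (\<Sum>(i, j)\<in>E. cmod (D i j))))"
    by (simp add: algebra_simps)
  have "l1_norm_on (E \<union> Id) D = (\<Sum>(i, j)\<in>E. cmod (D i j)) + (\<Sum>(i, j)\<in>Id. cmod (D i j))"
    unfolding l1_norm_on_def using \<open>irrefl E\<close>
    by (intro sum.union_disjoint) (auto simp: irrefl_def)
  moreover have "(\<Sum>(i, j)\<in>Id. cmod (D i j)) = (\<Sum>i\<in>UNIV. cmod (D i i))"
    by (rule sum.reindex_bij_witness[of _ "\<lambda>i. (i, i)" fst]) auto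
  ultimately have "l1_norm_on (E \<union> Id) D = (\<Sum>i\<in>UNIV. cmod (D i i)) + (\<Sum>(i, j)\<in>E. cmod (D i j))"
    by simp
  then show ?thesis using * by simp
qed

text \<open>The vectors y_k - a_k b are orthogonal to b, and subtracting a multiple of b does not change
v_i b_j - v_j b_i; the spectral gap therefore bounds their total squared norm by the edge energy
divided by \<lambda>_2. The sum of |a_k|^2 is recovered from the trace of \<Sum>k. y_k y_k^* by
Pythagoras.\<close>

lemma rank_one_projection_bounds:
  fixes b :: "complex ^ 'N" and y :: "nat \<Rightarrow> complex ^ 'N" and m :: nat
  assumes E: "irrefl E" "sym E" and card: "CARD('N) \<ge> 2" and "b \<noteq> 0"
    and lam: "lambda2 E b > 0"
    and d: "l1_norm_on (E \<union> Id) (\<lambda>i j. (\<Sum>k<m. y k $ i * cnj (y k $ j)) - b $ i * cnj (b $ j)) \<le> \<delta>"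
  defines "a \<equiv> \<lambda>k. hinner b (y k) / of_real ((norm b)\<^sup>2)"
    and "\<tau> \<equiv> \<delta> / lambda2 E b"
  shows "(\<Sum>k<m. (norm (y k - a k *s b))\<^sup>2) \<le> \<tau> * (norm b)\<^sup>2"
    and "\<bar>(\<Sum>k<m. (cmod (a k))\<^sup>2) - 1\<bar> \<le> 2 * \<tau>"
    and "(\<Sum>k<m. (cmod (a k))\<^sup>2) \<le> 1 + \<tau>"
proof -
  define D where "D = (\<lambda>i j. (\<Sum>k<m. y k $ i * cnj (y k $ j)) - b $ i * cnj (b $ j))"
  define r where "r k = y k - a k *s b" for k
  define n where "n = (norm b)\<^sup>2"
  have n: "n > 0" using \<open>b \<noteq> 0\<close> by (simp add: n_def)
  have orth: "hinner b (r k) = 0" for k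
    using \<open>b \<noteq> 0\<close> by (simp add: r_def a_def hinner_simps hinner_self)
  have energy: "lambda2 E b * (norm (r k))\<^sup>2
      \<le> (\<Sum>(i, j)\<in>E. (cmod (y k $ i * b $ j - y k $ j * b $ i))\<^sup>2) / 2" for k
  proof -
    have "r k $ i * b $ j - r k $ j * b $ i = y k $ i * b $ j - y k $ j * b $ i" for i j
      by (simp add: r_def algebra_simps)
    then show ?thesis
      using lambda2_le_complex_quadratic_form[OF E card \<open>b \<noteq> 0\<close> orth, of k] by simp
  qed
  have "lambda2 E b * (\<Sum>k<m. (norm (r k))\<^sup>2)
      \<le> (\<Sum>k<m. (\<Sum>(i, j)\<in>E. (cmod (y k $ i * b $ j - y k $ j * b $ i))\<^sup>2) / 2)"
    unfolding sum_distrib_left by (intro sum_mono energy)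
  also have "\<dots> = (\<Sum>k<m. \<Sum>(i, j)\<in>E. (cmod (y k $ i * b $ j - y k $ j * b $ i))\<^sup>2) / 2"
    by (rule sum_divide_distrib[symmetric])
  also have "\<dots> \<le> n * l1_norm_on (E \<union> Id) D"
    unfolding n_def D_def by (rule edge_energy_le[OF E(1)])
  also have "\<dots> \<le> n * \<delta>" using d n by (simp add: D_def)
  finally have R: "(\<Sum>k<m. (norm (r k))\<^sup>2) \<le> \<tau> * n"
    using lam by (simp add: \<tau>_def field_simps)
  then show "(\<Sum>k<m. (norm (y k - a k *s b))\<^sup>2) \<le> \<tau> * (norm b)\<^sup>2"
    by (simp add: r_def n_def)
  have nonneg: "0 \<le> (\<Sum>k<m. (norm (r k))\<^sup>2)" by (simp add: sum_nonneg)
  have pyth: "(norm (y k))\<^sup>2 = (cmod (a k))\<^sup>2 * n + (norm (r k))\<^sup>2" for k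
  proof -
    have "y k = r k - (- a k) *s b" by (simp add: r_def vec_eq_iff)
    then show ?thesis
      using norm_diff_smult_sq[of "r k" "- a k" b] orth[of k] cnj_hinner[of b "r k"]
      by (simp add: n_def)
  qed
  have "(\<Sum>k<m. (norm (y k))\<^sup>2) - n = (\<Sum>i\<in>UNIV. Re (D i i))"
  proof -
    have "(\<Sum>i\<in>UNIV. Re (D i i)) = (\<Sum>i\<in>UNIV. \<Sum>k<m. (cmod (y k $ i))\<^sup>2) - (\<Sum>i\<in>UNIV. (cmod (b $ i))\<^sup>2)"
      by (simp add: D_def sum_subtractf cmod_power2 flip: power2_eq_square)
    also have "(\<Sum>i\<in>UNIV. \<Sum>k<m. (cmod (y k $ i))\<^sup>2) = (\<Sum>k<m. \<Sum>i\<in>UNIV. (cmod (y k $ i))\<^sup>2)"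
      by (rule sum.swap)
    finally show ?thesis by (simp add: n_def norm_vec_def L2_set_def sum_nonneg)
  qed
  then have "\<bar>(\<Sum>k<m. (norm (y k))\<^sup>2) - n\<bar> = \<bar>\<Sum>i\<in>UNIV. Re (D i i)\<bar>" by simp
  also have "\<dots> \<le> (\<Sum>i\<in>UNIV. cmod (D i i))"
    by (rule order.trans[OF sum_abs sum_mono]) (rule abs_Re_le_cmod)
  also have "\<dots> = (\<Sum>(i, j)\<in>Id. cmod (D i j))"
    by (rule sum.reindex_bij_witness[of _ fst "\<lambda>i. (i, i)"]) auto
  also have "\<dots> \<le> l1_norm_on (E \<union> Id) D"
    unfolding l1_norm_on_def by (intro sum_mono2) auto
  also have "\<dots> \<le> \<delta>" using d by (simp add: D_def)
  also have "\<dots> \<le> \<tau> * n"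
  proof -
    have "0 \<le> l1_norm_on (E \<union> Id) D" unfolding l1_norm_on_def by (auto intro!: sum_nonneg)
    then have "0 \<le> \<delta>" using d by (simp add: D_def)
    then have "\<delta> * lambda2 E b \<le> \<delta> * n"
      unfolding n_def using lambda2_le_norm_sq[OF E card \<open>b \<noteq> 0\<close>] by (rule mult_left_mono[rotated])
    then show ?thesis using lam by (simp add: \<tau>_def field_simps)
  qed
  finally have S: "\<bar>(\<Sum>k<m. (norm (y k))\<^sup>2) - n\<bar> \<le> \<tau> * n" .
  have "(\<Sum>k<m. (norm (y k))\<^sup>2) = (\<Sum>k<m. (cmod (a k))\<^sup>2) * n + (\<Sum>k<m. (norm (r k))\<^sup>2)"
    by (simp add: pyth sum.distrib sum_distrib_right)
  then have "((\<Sum>k<m. (cmod (a k))\<^sup>2) - 1) * n \<le> \<tau> * n" "- (2 * \<tau>) * n \<le> ((\<Sum>k<m. (cmod (a k))\<^sup>2) - 1) * n"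
    using S R nonneg by (simp_all add: algebra_simps)
  then have *: "(\<Sum>k<m. (cmod (a k))\<^sup>2) - 1 \<le> \<tau>" "- (2 * \<tau>) \<le> (\<Sum>k<m. (cmod (a k))\<^sup>2) - 1"
    using n by (simp_all only: mult_le_cancel_right_pos)
  then show "(\<Sum>k<m. (cmod (a k))\<^sup>2) \<le> 1 + \<tau>" by simp
  have "0 \<le> \<tau> * n" using R nonneg by linarith
  then have "0 \<le> \<tau>" using n by (simp add: zero_le_mult_iff)
  then show "\<bar>(\<Sum>k<m. (cmod (a k))\<^sup>2) - 1\<bar> \<le> 2 * \<tau>" using * by linarith
qed

text \<open>With h = \<langle>x_0, v\<rangle> and g_k = \<langle>w_k, v\<rangle>, expanding the products sorts the
error into a multiple of x_0, a multiple of \<Sum>k. cnj(a_k) w_k, and \<Sum>k. g_k w_k. The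
mixed sum c = \<Sum>k. |a_k| \<parallel>w_k\<parallel>, which occurs twice, is of order \<kappa> sqrt \<tau> \<parallel>x_0\<parallel> by
Cauchy-Schwarz. With sqrt \<tau> \<le> 0.708 the constants add up to 3 * 0.708 + 2.46 < 4.6,
where 1.23^2 \<ge> 1 + \<tau>.\<close>

lemma rank_one_perturbation_bound:
  fixes x0 v :: "complex ^ 'n" and w :: "nat \<Rightarrow> complex ^ 'n" and m :: nat
  assumes s: "\<bar>(\<Sum>k<m. (cmod (a k))\<^sup>2) - 1\<bar> \<le> 2 * \<tau>" "(\<Sum>k<m. (cmod (a k))\<^sup>2) \<le> 1 + \<tau>"
    and w: "(\<Sum>k<m. (norm (w k))\<^sup>2) \<le> \<kappa>\<^sup>2 * \<tau> * (norm x0)\<^sup>2"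
    and "0 \<le> \<tau>" "\<tau> \<le> 1 / 2" "1 \<le> \<kappa>"
  shows "norm ((\<Sum>k<m. hinner (a k *s x0 + w k) v *s (a k *s x0 + w k)) - hinner x0 v *s x0)
    \<le> 4.6 * \<kappa>\<^sup>2 * sqrt \<tau> * (norm x0)\<^sup>2 * norm v"
proof -
  define n where "n = norm x0"
  define h where "h = hinner x0 v"
  define g where "g k = hinner (w k) v" for k
  define s where "s = (\<Sum>k<m. (cmod (a k))\<^sup>2)"
  define c where "c = (\<Sum>k<m. cmod (a k) * norm (w k))"
  define t where "t = sqrt \<tau>"
  have t: "0 \<le> t" "t\<^sup>2 = \<tau>" using \<open>0 \<le> \<tau>\<close> by (simp_all add: t_def)
  have "t\<^sup>2 \<le> 0.708\<^sup>2" using t(2) \<open>\<tau> \<le> 1 / 2\<close> by (simp add: power2_eq_square)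
  then have t_le: "t \<le> 0.708" by (rule power2_le_imp_le) simp
  have n0: "0 \<le> n" by (simp add: n_def)
  have h_le: "cmod h \<le> n * norm v" and g_le: "cmod (g k) \<le> norm (w k) * norm v" for k
    unfolding h_def g_def n_def by (rule norm_hinner_le)+
  have c_le: "c \<le> 1.23 * \<kappa> * t * n"
  proof (rule power2_le_imp_le)
    have "c\<^sup>2 \<le> s * (\<Sum>k<m. (norm (w k))\<^sup>2)"
      unfolding c_def s_def by (rule Cauchy_Schwarz_ineq_sum)
    also have "\<dots> \<le> (1 + \<tau>) * (\<kappa>\<^sup>2 * \<tau> * n\<^sup>2)"
      unfolding s_def n_def using assms by (intro mult_mono) (auto intro: sum_nonneg)
    also have "\<dots> \<le> 1.23\<^sup>2 * (\<kappa>\<^sup>2 * \<tau> * n\<^sup>2)"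
      using \<open>0 \<le> \<tau>\<close> \<open>\<tau> \<le> 1 / 2\<close> by (intro mult_right_mono) (auto simp: power2_eq_square)
    also have "\<dots> = (1.23 * \<kappa> * t * n)\<^sup>2" by (simp add: power_mult_distrib power_divide flip: t(2))
    finally show "c\<^sup>2 \<le> (1.23 * \<kappa> * t * n)\<^sup>2" .
    show "0 \<le> 1.23 * \<kappa> * t * n" using t(1) n0 \<open>1 \<le> \<kappa>\<close> by simp
  qed
  have hx: "hinner (a k *s x0 + w k) v = cnj (a k) * h + g k" for k
    by (simp add: hinner_simps h_def g_def)
  have split: "(\<Sum>k<m. hinner (a k *s x0 + w k) v *s (a k *s x0 + w k)) - h *s x0
      = (of_real (s - 1) * h + (\<Sum>k<m. a k * g k)) *s x0
        + h *s (\<Sum>k<m. cnj (a k) *s w k) + (\<Sum>k<m. g k *s w k)"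
    unfolding hx s_def of_real_diff of_real_sum complex_norm_square
    by (simp add: vec_eq_iff sum.distrib sum_distrib_left sum_distrib_right algebra_simps)
  have "norm ((of_real (s - 1) * h + (\<Sum>k<m. a k * g k)) *s x0)
      \<le> (\<bar>s - 1\<bar> * (n * norm v) + c * norm v) * n"
  proof -
    have "cmod (\<Sum>k<m. a k * g k) \<le> (\<Sum>k<m. cmod (a k) * (norm (w k) * norm v))"
      by (rule sum_norm_le) (auto simp: norm_mult intro!: mult_left_mono g_le)
    also have "\<dots> = c * norm v" by (simp add: c_def sum_distrib_right mult.assoc)
    finally have "cmod (of_real (s - 1) * h + (\<Sum>k<m. a k * g k)) \<le> \<bar>s - 1\<bar> * (n * norm v) + c * norm v"
      using h_le by (intro order.trans[OF norm_triangle_ineq] add_mono)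
        (auto simp: norm_mult simp del: of_real_diff intro!: mult_left_mono)
    then show ?thesis unfolding norm_vector_smult n_def by (rule mult_right_mono) simp
  qed
  moreover have "norm (h *s (\<Sum>k<m. cnj (a k) *s w k)) \<le> (n * norm v) * c"
  proof -
    have "norm (\<Sum>k<m. cnj (a k) *s w k) \<le> c"
      unfolding c_def by (rule sum_norm_le) (simp add: norm_vector_smult)
    then show ?thesis unfolding norm_vector_smult using h_le n0 by (intro mult_mono) auto
  qed
  moreover have "norm (\<Sum>k<m. g k *s w k) \<le> (\<Sum>k<m. (norm (w k))\<^sup>2) * norm v"
  proof -
    have "norm (g k *s w k) \<le> (norm (w k))\<^sup>2 * norm v" for k
      using mult_right_mono[OF g_le[of k], of "norm (w k)"]
      by (simp add: norm_vector_smult power2_eq_square mult_ac)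
    then show ?thesis unfolding sum_distrib_right by (intro sum_norm_le)
  qed
  ultimately have "norm ((\<Sum>k<m. hinner (a k *s x0 + w k) v *s (a k *s x0 + w k)) - h *s x0)
      \<le> (\<bar>s - 1\<bar> * (n * norm v) + c * norm v) * n + (n * norm v) * c + (\<Sum>k<m. (norm (w k))\<^sup>2) * norm v"
    unfolding split by (meson norm_triangle_le add_mono order.trans)
  also have "\<dots> \<le> (2 * \<tau> * (n * norm v) + (1.23 * \<kappa> * t * n) * norm v) * n
      + (n * norm v) * (1.23 * \<kappa> * t * n) + \<kappa>\<^sup>2 * \<tau> * n\<^sup>2 * norm v"
    using assms(1) w c_le n0 unfolding s_def[symmetric] n_def[symmetric]
    by (intro add_mono mult_mono mult_right_mono mult_left_mono) auto
  also have "\<dots> = (2 * t\<^sup>2 + 2.46 * \<kappa> * t + \<kappa>\<^sup>2 * t\<^sup>2) * (n\<^sup>2 * norm v)"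
    by (simp add: t(2)[symmetric] power2_eq_square algebra_simps)
  also have "\<dots> \<le> (4.6 * \<kappa>\<^sup>2 * t) * (n\<^sup>2 * norm v)"
  proof (rule mult_right_mono)
    have k: "1 \<le> \<kappa>\<^sup>2" "\<kappa> \<le> \<kappa>\<^sup>2"
      using \<open>1 \<le> \<kappa>\<close> by (simp_all add: power2_eq_square mult_le_cancel_left1 one_le_power mult_ge1_I)
    have "t\<^sup>2 \<le> 0.708 * t" 
      unfolding power2_eq_square using t_le t(1) by (rule mult_right_mono)
    have "2 * t\<^sup>2 \<le> \<kappa>\<^sup>2 * (2 * t\<^sup>2)" using mult_right_mono[OF k(1), of "2 * t\<^sup>2"] by simp
    moreover have "2.46 * \<kappa> * t \<le> \<kappa>\<^sup>2 * (2.46 * t)" using mult_right_mono[OF k(2), of "2.46 * t"] t(1) by simp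
    moreover have "\<kappa>\<^sup>2 * (3 * t\<^sup>2 + 2.46 * t) \<le> \<kappa>\<^sup>2 * (4.6 * t)"
      using \<open>t\<^sup>2 \<le> 0.708 * t\<close> t(1) by (intro mult_left_mono) (linarith | simp)+
    ultimately show "2 * t\<^sup>2 + 2.46 * \<kappa> * t + \<kappa>\<^sup>2 * t\<^sup>2 \<le> 4.6 * \<kappa>\<^sup>2 * t"
      by (simp add: algebra_simps)
  qed simp
  finally show ?thesis by (simp add: n_def h_def t_def mult_ac)
qed


section \<open>The leading eigenvector of a matrix close to rank one\<close>

text \<open>Here e is the largest eigenvalue relative to \<parallel>x_0\<parallel>^2 and \<gamma> the cosine of the angle
between x_0 and the eigenvector; the left-hand side is the squared relative error after the
phases are aligned. It equals (sqrt e - 1)^2 + 2 sqrt e (1 - \<gamma>). The residual hypothesis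
makes the sine of the angle, not only its square, of order \<mu>, which is what keeps the bound
quadratic in \<mu>. For \<mu> > 1/2 the error is trivially at most 2 + \<mu>.\<close>

lemma scaled_eigenvector_error_le:
  fixes e \<gamma> \<mu> :: real
  assumes "0 \<le> e" "0 \<le> \<gamma>" "\<gamma> \<le> 1" "0 \<le> \<mu>" and e: "\<bar>e - 1\<bar> \<le> \<mu>"
    and res: "e\<^sup>2 * (1 - \<gamma>\<^sup>2) \<le> \<mu>\<^sup>2"
  shows "e + 1 - 2 * sqrt e * \<gamma> \<le> 10 * \<mu>\<^sup>2"
proof (cases "\<mu> \<le> 1 / 2")
  case True
  define s where "s = sqrt e"
  have s: "0 \<le> s" "s\<^sup>2 = e" using \<open>0 \<le> e\<close> by (simp_all add: s_def)
  have "0.7\<^sup>2 \<le> s\<^sup>2" using s(2) e True by (simp add: power2_eq_square)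
  then have s7: "0.7 \<le> s" by (rule power2_le_imp_le) (use s in simp)
  have "\<bar>s - 1\<bar> * 1 \<le> \<bar>s - 1\<bar> * (s + 1)" using s(1) by (intro mult_left_mono) auto
  also have "\<dots> = \<bar>e - 1\<bar>"
  proof -
    have "e - 1 = (s - 1) * (s + 1)" by (simp add: s(2)[symmetric] power2_eq_square algebra_simps)
    then show ?thesis using s(1) by (simp add: abs_mult)
  qed
  finally have "\<bar>s - 1\<bar> \<le> \<mu>" using e by simp
  then have 1: "(s - 1)\<^sup>2 \<le> \<mu>\<^sup>2" by (rule abs_le_square_iff[THEN iffD1, OF order.trans]) (simp add: \<open>0 \<le> \<mu>\<close>)
  have "s ^ 3 \<ge> 0.7 ^ 3" using s7 by (intro power_mono) auto
  then have "1 / 3 \<le> s ^ 3" by (simp add: power3_eq_cube)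
  have "\<gamma>\<^sup>2 \<le> \<gamma>" using assms by (simp add: power2_eq_square mult_le_one mult_left_le)
  have "(1 / 3) * (s * (1 - \<gamma>)) \<le> s ^ 3 * (s * (1 - \<gamma>))"
    using \<open>1 / 3 \<le> s ^ 3\<close> s(1) assms by (intro mult_right_mono) auto
  also have "\<dots> = e\<^sup>2 * (1 - \<gamma>)" by (simp add: s(2)[symmetric] power2_eq_square power3_eq_cube)
  also have "\<dots> \<le> e\<^sup>2 * (1 - \<gamma>\<^sup>2)" using \<open>\<gamma>\<^sup>2 \<le> \<gamma>\<close> by (intro mult_left_mono) auto
  also have "\<dots> \<le> \<mu>\<^sup>2" by (rule res)
  finally have 2: "2 * (s * (1 - \<gamma>)) \<le> 6 * \<mu>\<^sup>2" by simp
  have "e + 1 - 2 * sqrt e * \<gamma> = (s - 1)\<^sup>2 + 2 * (s * (1 - \<gamma>))"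
    unfolding s_def[symmetric] by (simp add: s(2)[symmetric] power2_eq_square algebra_simps)
  also have "\<dots> \<le> 10 * \<mu>\<^sup>2" using 1 2 zero_le_power2[of \<mu>] by linarith
  finally show ?thesis .
next
  case False
  then have "(1 / 2)\<^sup>2 \<le> \<mu>\<^sup>2" "(1 / 2) * \<mu> \<le> \<mu> * \<mu>" by (intro power_mono mult_right_mono; simp)+
  then have "2 + \<mu> \<le> 10 * \<mu>\<^sup>2" by (simp add: power2_eq_square)
  moreover have "0 \<le> sqrt e * \<gamma>" using assms by simp
  ultimately show ?thesis using e by linarith
qed

text \<open>Comparing quadratic forms at x_0 and at x_1 pins \<eta> to within \<mu> \<parallel>x_0\<parallel>^2 of \<parallel>x_0\<parallel>^2.
For the direction, applying the hypothesis to the eigenvector itself gives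
\<parallel>\<eta> x_1 - \<langle>x_0, x_1\<rangle> x_0\<parallel> \<le> \<mu> \<parallel>x_0\<parallel>^2, so the part of x_1 orthogonal to x_0
is of size \<mu>. The phase \<alpha> is the argument of \<langle>x_0, x_1\<rangle>.\<close>

lemma top_eigenvector_near_rank_one:
  fixes X :: "complex ^ 'n ^ 'n" and x0 x1 :: "complex ^ 'n"
  assumes X: "hermitian_psd X" and top: "is_largest_eigenvalue X \<eta>"
    and x1: "X *v x1 = of_real \<eta> *s x1" "norm x1 = 1" and "x0 \<noteq> 0" and "0 \<le> \<mu>"
    and near: "\<And>v. norm (X *v v - hinner x0 v *s x0) \<le> \<mu> * (norm x0)\<^sup>2 * norm v"
  shows "\<exists>\<alpha>\<in>{0..<2 * pi}. (norm (of_real (sqrt \<eta>) *s x1 - exp (\<i> * of_real \<alpha>) *s x0))\<^sup>2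
    \<le> 10 * \<mu>\<^sup>2 * (norm x0)\<^sup>2"
proof -
  define n where "n = norm x0"
  have n: "n > 0" using \<open>x0 \<noteq> 0\<close> by (simp add: n_def)
  define g where "g = hinner x0 x1"
  define c where "c = cmod g"
  have h: "hermitian X" and psd: "\<And>v. 0 \<le> Re (hinner v (X *v v))"
    using X by (auto simp: hermitian_psd_iff)
  have c: "0 \<le> c" "c \<le> n" using norm_hinner_le[of x0 x1] x1(2) by (simp_all add: c_def g_def n_def)
  have x1X: "Re (hinner x1 (X *v x1)) = \<eta>" by (simp add: x1 hinner_simps hinner_self)
  have "0 \<le> \<eta>" using psd[of x1] x1X by simp
  have form: "\<bar>Re (hinner v (X *v v)) - (cmod (hinner x0 v))\<^sup>2\<bar> \<le> \<mu> * n\<^sup>2 * (norm v)\<^sup>2" for v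
  proof -
    have "hinner v (X *v v - hinner x0 v *s x0) = hinner v (X *v v) - of_real ((cmod (hinner x0 v))\<^sup>2)"
      by (simp only: hinner_simps complex_norm_square cnj_hinner)
    then have "\<bar>Re (hinner v (X *v v)) - (cmod (hinner x0 v))\<^sup>2\<bar> = \<bar>Re (hinner v (X *v v - hinner x0 v *s x0))\<bar>"
      by simp
    also have "\<dots> \<le> norm v * norm (X *v v - hinner x0 v *s x0)"
      by (rule order.trans[OF abs_Re_le_cmod norm_hinner_le])
    also have "\<dots> \<le> norm v * (\<mu> * n\<^sup>2 * norm v)"
      unfolding n_def by (intro mult_left_mono near) simp
    finally show ?thesis by (simp add: power2_eq_square mult_ac)
  qed
  have upper: "\<eta> \<le> (1 + \<mu>) * n\<^sup>2"
  proof -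
    have "\<eta> \<le> c\<^sup>2 + \<mu> * n\<^sup>2" using form[of x1] x1X x1(2) by (simp add: c_def g_def)
    also have "c\<^sup>2 \<le> n\<^sup>2" using c by (intro power_mono)
    finally show ?thesis by (simp add: algebra_simps)
  qed
  have lower: "(1 - \<mu>) * n\<^sup>2 \<le> \<eta>"
  proof -
    have "cmod (hinner x0 x0) = n\<^sup>2" unfolding hinner_self norm_of_real n_def by simp
    then have "((1 - \<mu>) * n\<^sup>2) * n\<^sup>2 \<le> Re (hinner x0 (X *v x0))"
      using form[of x0] by (simp add: n_def[symmetric] power2_eq_square algebra_simps)
    also have "\<dots> \<le> \<eta> * n\<^sup>2" unfolding n_def by (rule largest_eigenvalue_rayleigh[OF h top])
    finally show ?thesis using n by (simp add: mult_le_cancel_right)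
  qed
  have residual: "\<eta>\<^sup>2 + c\<^sup>2 * n\<^sup>2 - 2 * \<eta> * c\<^sup>2 \<le> \<mu>\<^sup>2 * n ^ 4"
  proof -
    have "(norm (of_real \<eta> *s x1 - g *s x0))\<^sup>2 \<le> (\<mu> * n\<^sup>2)\<^sup>2"
      using near[of x1] x1 by (intro power_mono) (simp_all add: g_def n_def)
    moreover have "Re (g * hinner (of_real \<eta> *s x1) x0) = \<eta> * c\<^sup>2"
    proof -
      have "g * hinner (of_real \<eta> *s x1) x0 = of_real \<eta> * (g * cnj g)"
        by (simp add: hinner_simps g_def cnj_hinner)
      also have "\<dots> = of_real (\<eta> * c\<^sup>2)"
        by (simp only: complex_norm_square[symmetric] c_def of_real_mult)
      finally show ?thesis by simp
    qed
    ultimately show ?thesis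
      using \<open>0 \<le> \<eta>\<close> x1(2) unfolding norm_diff_smult_sq norm_vector_smult
      by (simp add: c_def n_def power_mult_distrib)
  qed
  define \<alpha> where "\<alpha> = Arg2pi g"
  have \<alpha>: "0 \<le> \<alpha>" "\<alpha> < 2 * pi" "g = of_real c * exp (\<i> * of_real \<alpha>)"
    using Arg2pi[of g] by (simp_all add: \<alpha>_def c_def is_Arg_def)
  define e where "e = \<eta> / n\<^sup>2"
  define \<gamma> where "\<gamma> = c / n"
  have "e + 1 - 2 * sqrt e * \<gamma> \<le> 10 * \<mu>\<^sup>2"
  proof (rule scaled_eigenvector_error_le)
    show "0 \<le> e" "0 \<le> \<gamma>" "\<gamma> \<le> 1" "0 \<le> \<mu>"
      using \<open>0 \<le> \<eta>\<close> c n \<open>0 \<le> \<mu>\<close> by (simp_all add: e_def \<gamma>_def)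
    have "(1 - \<mu>) \<le> e" "e \<le> 1 + \<mu>" using lower upper n by (simp_all add: e_def pos_le_divide_eq pos_divide_le_eq)
    then show "\<bar>e - 1\<bar> \<le> \<mu>" by linarith
    \<comment> \<open>Split the squared residual into its parts orthogonal and parallel to x_0; only the former is kept.\<close>
    have "\<eta>\<^sup>2 * (n\<^sup>2 - c\<^sup>2) + c\<^sup>2 * (n\<^sup>2 - \<eta>)\<^sup>2 = (\<eta>\<^sup>2 + c\<^sup>2 * n\<^sup>2 - 2 * \<eta> * c\<^sup>2) * n\<^sup>2"
      by (simp add: power2_eq_square algebra_simps)
    also have "\<dots> \<le> \<mu>\<^sup>2 * n ^ 4 * n\<^sup>2" using residual by (intro mult_right_mono) auto
    finally have "\<eta>\<^sup>2 * (n\<^sup>2 - c\<^sup>2) + c\<^sup>2 * (n\<^sup>2 - \<eta>)\<^sup>2 \<le> \<mu>\<^sup>2 * n ^ 4 * n\<^sup>2" .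
    then have "\<eta>\<^sup>2 * (n\<^sup>2 - c\<^sup>2) \<le> \<mu>\<^sup>2 * (n ^ 4 * n\<^sup>2)"
    proof -
      have "0 \<le> c\<^sup>2 * (n\<^sup>2 - \<eta>)\<^sup>2" by simp
      with \<open>\<eta>\<^sup>2 * (n\<^sup>2 - c\<^sup>2) + c\<^sup>2 * (n\<^sup>2 - \<eta>)\<^sup>2 \<le> \<mu>\<^sup>2 * n ^ 4 * n\<^sup>2\<close> show ?thesis
        unfolding mult.assoc by linarith
    qed
    moreover have "e\<^sup>2 * (1 - \<gamma>\<^sup>2) = \<eta>\<^sup>2 * (n\<^sup>2 - c\<^sup>2) / (n ^ 4 * n\<^sup>2)"
      using n by (simp add: e_def \<gamma>_def field_simps power2_eq_square power4_eq_xxxx)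
    ultimately show "e\<^sup>2 * (1 - \<gamma>\<^sup>2) \<le> \<mu>\<^sup>2" using n by (simp add: pos_divide_le_eq)
  qed
  then have "(e + 1 - 2 * sqrt e * \<gamma>) * n\<^sup>2 \<le> 10 * \<mu>\<^sup>2 * n\<^sup>2" by (rule mult_right_mono) simp
  moreover have "(e + 1 - 2 * sqrt e * \<gamma>) * n\<^sup>2 = \<eta> + n\<^sup>2 - 2 * sqrt \<eta> * c"
    using n by (simp add: e_def \<gamma>_def real_sqrt_divide field_simps power2_eq_square)
  moreover have "(norm (of_real (sqrt \<eta>) *s x1 - exp (\<i> * of_real \<alpha>) *s x0))\<^sup>2 = \<eta> + n\<^sup>2 - 2 * sqrt \<eta> * c"
  proof -
    have "hinner x1 x0 = cnj g" by (simp add: g_def cnj_hinner)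
    then have "exp (\<i> * of_real \<alpha>) * hinner (of_real (sqrt \<eta>) *s x1) x0
        = of_real (sqrt \<eta> * c) * (exp (\<i> * of_real \<alpha>) * cnj (exp (\<i> * of_real \<alpha>)))"
      unfolding \<alpha>(3) by (simp add: hinner_simps mult_ac)
    also have "\<dots> = of_real (sqrt \<eta> * c)"
      by (simp only: complex_norm_square[symmetric]) simp
    finally show ?thesis
      using \<open>0 \<le> \<eta>\<close> x1(2) unfolding norm_diff_smult_sq norm_vector_smult
      by (simp add: n_def)
  qed
  ultimately show ?thesis using \<alpha>(1,2) by (intro bexI[of _ \<alpha>]) (simp_all add: n_def)
qed


section \<open>The error bound\<close>

theorem theorem4:
  fixes A :: "complex ^ 'n ^ 'N"
    and x0 :: "complex ^ 'n"
    and b :: "complex ^ 'N"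
    and E :: "('N \<times> 'N) set"
    and B \<epsilon> :: "'N \<Rightarrow> 'N \<Rightarrow> complex"
    and \<sigma> \<eta>1 :: real
    and X :: "complex ^ 'n ^ 'n"
    and x1 x :: "complex ^ 'n"
  assumes "CARD('N) \<ge> 2"
    and "\<exists>A' :: complex ^ 'N ^ 'n. A' ** A = mat 1"
    and "b = A *v x0"
    and "sym E" and "irrefl E"
    and "\<forall>(i, j) \<in> E \<union> Id. B i j = b $ i * cnj (b $ j) + \<epsilon> i j"
    and "\<forall>(i, j) \<in> E \<union> Id. \<epsilon> i j = cnj (\<epsilon> j i)"
    and "\<sigma> \<ge> 0"
    and "lambda2 E b > 0"
    and "l1_norm_on (E \<union> Id) \<epsilon> + \<sigma> \<le> lambda2 E b / 2"
    and "hermitian_psd X"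
    and "l1_norm_on (E \<union> Id) (\<lambda>i j. (A ** X ** conj_transpose A) $ i $ j - B i j) \<le> \<sigma>"
    and "is_largest_eigenvalue X \<eta>1"
    and "is_eigenvector X (of_real \<eta>1) x1" and "norm x1 = 1"
    and "x = of_real (sqrt \<eta>1) *s x1"
  shows "\<exists>\<alpha>\<in>{0..<2 * pi}.
           norm (x - exp (\<i> * of_real \<alpha>) *s x0) / norm x0
             \<le> 15 * (condition_number A)\<^sup>2 * sqrt ((l1_norm_on (E \<union> Id) \<epsilon> + \<sigma>) / lambda2 E b)"
proof (cases "x0 = 0")
  case True
  have "0 \<le> l1_norm_on (E \<union> Id) \<epsilon>" unfolding l1_norm_on_def by (auto intro!: sum_nonneg)
  then have "0 \<le> (l1_norm_on (E \<union> Id) \<epsilon> + \<sigma>) / lambda2 E b" using assms(8,9) by simp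
  then show ?thesis using True pi_gt_zero by (intro bexI[of _ 0]) auto
next
  case False
  define \<delta> where "\<delta> = l1_norm_on (E \<union> Id) \<epsilon> + \<sigma>"
  define \<tau> where "\<tau> = \<delta> / lambda2 E b"
  define P where "P = pseudoinverse A"
  define \<kappa> where "\<kappa> = condition_number A"
  have "0 \<le> l1_norm_on (E \<union> Id) \<epsilon>" unfolding l1_norm_on_def by (auto intro!: sum_nonneg)
  then have "0 \<le> \<delta>" using assms(8) by (simp add: \<delta>_def)
  then have \<tau>: "0 \<le> \<tau>" "\<tau> \<le> 1 / 2"
    using assms(9,10) unfolding \<tau>_def \<delta>_def[symmetric] by (simp_all add: field_simps)
  have PA: "P *v (A *v v) = v" for v
    using left_inverse_pseudoinverse[OF assms(2)]
    by (simp add: P_def matrix_vector_mul_assoc)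
  have \<kappa>: "\<kappa> = spectral_norm A * spectral_norm P"
    by (simp add: \<kappa>_def condition_number_def P_def)
  have Pb: "norm (P *v b) = norm x0" by (simp add: assms(3) PA)
  have "b \<noteq> 0" using Pb False by auto
  have b_le: "spectral_norm P * norm b \<le> \<kappa> * norm x0"
    using mult_left_mono[OF spectral_norm_bound(1)[of A x0] spectral_norm_bound(2)[of P]]
    by (simp add: assms(3) \<kappa> mult_ac)
  \<comment> \<open>Since P b = x_0, the condition number is at least 1.\<close>
  have "norm x0 \<le> spectral_norm P * norm b"
    using spectral_norm_bound(1)[of P b] by (simp add: Pb)
  then have "1 * norm x0 \<le> \<kappa> * norm x0" using b_le by simp
  then have "1 \<le> \<kappa>" using False by (simp add: mult_le_cancel_right)

  obtain m :: nat and xs :: "nat \<Rightarrow> complex ^ 'n"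
    where xs: "\<And>i j. X $ i $ j = (\<Sum>k<m. xs k $ i * cnj (xs k $ j))"
    using hermitian_psd_rank_one_sum[OF assms(11)] by blast
  define y where "y k = A *v xs k" for k
  define a where "a k = hinner b (y k) / of_real ((norm b)\<^sup>2)" for k
  define w where "w k = P *v (y k - a k *s b)" for k
  have Y: "(A ** X ** conj_transpose A) $ i $ j = (\<Sum>k<m. y k $ i * cnj (y k $ j))" for i j
    unfolding y_def by (rule rank_one_sum_congruence[OF xs])
  have "l1_norm_on (E \<union> Id) (\<lambda>i j. (\<Sum>k<m. y k $ i * cnj (y k $ j)) - b $ i * cnj (b $ j))
      \<le> l1_norm_on (E \<union> Id) (\<lambda>i j. (A ** X ** conj_transpose A) $ i $ j - B i j) + l1_norm_on (E \<union> Id) \<epsilon>"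
    unfolding l1_norm_on_def Y sum.distrib[symmetric]
  proof (intro sum_mono, clarify)
    fix i j assume "(i, j) \<in> E \<union> Id"
    then have "B i j = b $ i * cnj (b $ j) + \<epsilon> i j" using assms(6) by blast
    then have eq: "(\<Sum>k<m. y k $ i * cnj (y k $ j)) - b $ i * cnj (b $ j)
        = ((\<Sum>k<m. y k $ i * cnj (y k $ j)) - B i j) + \<epsilon> i j" by simp
    show "cmod ((\<Sum>k<m. y k $ i * cnj (y k $ j)) - b $ i * cnj (b $ j))
        \<le> cmod ((\<Sum>k<m. y k $ i * cnj (y k $ j)) - B i j) + cmod (\<epsilon> i j)"
      unfolding eq by (rule norm_triangle_ineq)
  qed
  then have "l1_norm_on (E \<union> Id) (\<lambda>i j. (\<Sum>k<m. y k $ i * cnj (y k $ j)) - b $ i * cnj (b $ j)) \<le> \<delta>"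
    using assms(12) by (simp add: \<delta>_def)
  note proj = rank_one_projection_bounds[OF assms(5,4,1) \<open>b \<noteq> 0\<close> assms(9) this,
      folded a_def \<tau>_def]
  have xs_split: "xs k = a k *s x0 + w k" for k
    by (simp add: w_def y_def matrix_vector_mult_diff_distrib PA assms(3) vector_scalar_commute)
  have w_le: "(\<Sum>k<m. (norm (w k))\<^sup>2) \<le> \<kappa>\<^sup>2 * \<tau> * (norm x0)\<^sup>2"
  proof -
    have "(\<Sum>k<m. (norm (w k))\<^sup>2) \<le> (\<Sum>k<m. (spectral_norm P * norm (y k - a k *s b))\<^sup>2)"
      unfolding w_def by (intro sum_mono power_mono spectral_norm_bound) auto
    also have "\<dots> = (spectral_norm P)\<^sup>2 * (\<Sum>k<m. (norm (y k - a k *s b))\<^sup>2)"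
      by (simp add: power_mult_distrib sum_distrib_left)
    also have "\<dots> \<le> (spectral_norm P)\<^sup>2 * (\<tau> * (norm b)\<^sup>2)"
      by (intro mult_left_mono proj) auto
    also have "\<dots> = \<tau> * (spectral_norm P * norm b)\<^sup>2" by (simp add: power_mult_distrib)
    also have "\<dots> \<le> \<tau> * (\<kappa> * norm x0)\<^sup>2"
      using \<tau>(1) b_le spectral_norm_bound(2)[of P] by (intro mult_left_mono power_mono) auto
    finally show ?thesis by (simp add: power_mult_distrib mult_ac)
  qed
  define \<mu> where "\<mu> = 4.6 * \<kappa>\<^sup>2 * sqrt \<tau>"
  have near: "norm (X *v v - hinner x0 v *s x0) \<le> \<mu> * (norm x0)\<^sup>2 * norm v" for v
    using rank_one_perturbation_bound[OF proj(2,3) w_le \<tau> \<open>1 \<le> \<kappa>\<close>, of v]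
    unfolding rank_one_sum_mult[OF xs] xs_split[symmetric] \<mu>_def by (simp add: mult_ac)
  have "0 \<le> \<mu>" using \<tau>(1) by (simp add: \<mu>_def)
  moreover have "X *v x1 = of_real \<eta>1 *s x1" using assms(14) by (simp add: is_eigenvector_def)
  ultimately obtain \<alpha> where \<alpha>: "\<alpha> \<in> {0..<2 * pi}"
    and err: "(norm (x - exp (\<i> * of_real \<alpha>) *s x0))\<^sup>2 \<le> 10 * \<mu>\<^sup>2 * (norm x0)\<^sup>2"
    using top_eigenvector_near_rank_one[OF assms(11,13) _ assms(15) False _ near] assms(16) by blast
  have "(norm (x - exp (\<i> * of_real \<alpha>) *s x0))\<^sup>2 \<le> (15 * \<kappa>\<^sup>2 * sqrt \<tau> * norm x0)\<^sup>2"
  proof -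
    define q where "q = \<kappa>\<^sup>2 * sqrt \<tau>"
    have "10 * (4.6 * q)\<^sup>2 \<le> (15 * q)\<^sup>2" by (simp add: power_mult_distrib power_divide)
    then have "10 * \<mu>\<^sup>2 \<le> (15 * \<kappa>\<^sup>2 * sqrt \<tau>)\<^sup>2"
      by (simp add: \<mu>_def q_def mult.assoc)
    then have "10 * \<mu>\<^sup>2 * (norm x0)\<^sup>2 \<le> (15 * \<kappa>\<^sup>2 * sqrt \<tau>)\<^sup>2 * (norm x0)\<^sup>2"
      by (rule mult_right_mono) simp
    with err show ?thesis by (simp add: power_mult_distrib)
  qed
  then have "norm (x - exp (\<i> * of_real \<alpha>) *s x0) \<le> 15 * \<kappa>\<^sup>2 * sqrt \<tau> * norm x0"
    by (rule power2_le_imp_le) (use \<tau>(1) in simp)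
  then have "norm (x - exp (\<i> * of_real \<alpha>) *s x0) / norm x0 \<le> 15 * \<kappa>\<^sup>2 * sqrt \<tau>"
    using False by (simp add: pos_divide_le_eq)
  with \<alpha> show ?thesis by (auto simp: \<kappa>_def \<tau>_def \<delta>_def)
qed

end
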